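(* Suppose that $\gamma_L(\Phi)<0$, where $$\gamma_L(\Phi):=\inf_{t>0}\left\{E\,\frac1t\log\left\|\prod_{i=1}^{t}\Phi(\underline{\eta}_{t-i})\right\|\right\},\qquad \Phi(\underline{\eta}_t):=\prod_{v=0}^{s-1}\phi_{s-v}(\underline{\eta}_t).$$ Then for all $t\in\mathbb{Z}$ the series $$\sum_{k=0}^{\infty}\left\{\prod_{j=0}^{k-1}A(\underline{\eta}_{t-j})\right\}\underline{B}(\underline{\eta}_{t-k})$$ converges almost surely, and the process $(\underline{Y}_t)_{t\in\mathbb{Z}}$ defined by $$\underline{Y}_t=\sum_{k=1}^{\infty}\left\{\prod_{j=0}^{k-1}A(\underline{\eta}_{t-j})\right\}\underline{B}(\underline{\eta}_{t-k})+\underline{B}(\underline{\eta}_t)$$ is the unique strictly stationary, causal and ergodic solution of $$\underline{Y}_t=A(\underline{\eta}_t)\underline{Y}_{t-1}+\underline{B}(\underline{\eta}_t),\qquad t\in\mathbb{Z}.$$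
   Context: Model. Fix integers $s,p,q\ge 1$ and put $d=p+q$. The periodic GARCH (PGARCH) process $(x_t)_{t\in\mathbb{Z}}$ of period $s$ satisfies, for $t\in\mathbb{Z}$ and $v=1,\dots,s$, $x_{st+v}=\varepsilon_{st+v}\sqrt{h_{st+v}}$ and $h_{st+v}=\alpha_0(v)+\sum_{i=1}^p\alpha_i(v)x_{st+v-i}^2+\sum_{j=1}^q\beta_j(v)h_{st+v-j}$, where $\alpha_0(v)>0$, $\alpha_i(v)\ge 0$, $\beta_j(v)\ge 0$ are constants. The $(\varepsilon_t)_{t\in\mathbb{Z}}$ are i.i.d. real random variables with $E\varepsilon_t=E\varepsilon_t^3=0$ and $E\varepsilon_t^2=1$; $\varepsilon_k$ is independent of $x_t$ for $k>t$. Vector form. Put $y_t=x_t^2$, $\eta_t=\varepsilon_t^2$, $\underline{\eta}_t=(\eta_{st+1},\dots,\eta_{st+s})'\in\mathbb{R}^s$ (an i.i.d. sequence), $\underline{y}_{st+v}=(y_{st+v},\dots,y_{st+v-p+1},h_{st+v},\dots,h_{st+v-q+1})'\in\mathbb{R}^d$ and $\underline{Y}_t=(\underline{y}_{st+1}',\dots,\underline{y}_{st+s}')'\in\mathbb{R}^{ds}$. For $v=1,\dots,s$, $\underline{B}_v(\underline{\eta}_t)\in\mathbb{R}^d$ has first coordinate $\alpha_0(v)\eta_{st+v}$, $(p+1)$-th coordinate $\alpha_0(v)$, and all other coordinates $0$; and $\phi_v(\underline{\eta}_t)$ is the $d\times d$ matrix $$\phi_v(\underline{\eta}_t)=\begin{pmatrix}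 A_v(\underline{\eta}_t) & B_v(\underline{\eta}_t) \\ A_v & B_v \end{pmatrix},$$ where: $A_v(\underline{\eta}_t)$ is the $p\times p$ matrix with first row $(\alpha_1(v)\eta_{st+v},\dots,\alpha_p(v)\eta_{st+v})$, ones on the first subdiagonal and zeros elsewhere; $B_v(\underline{\eta}_t)$ is the $p\times q$ matrix with first row $(\beta_1(v)\eta_{st+v},\dots,\beta_q(v)\eta_{st+v})$ and zeros elsewhere; $A_v$ is the $q\times p$ matrix with first row $(\alpha_1(v),\dots,\alpha_p(v))$ and zeros elsewhere; $B_v$ is the $q\times q$ matrix with first row $(\beta_1(v),\dots,\beta_q(v))$, ones on the first subdiagonal and zeros elsewhere. Products $\prod_{j=a}^{b}M_j$ of matrices are ordered $M_aM_{a+1}\cdots M_b$, and empty products are identity matrices. $A(\underline{\eta}_t)$ is the $ds\times ds$ matrix, in $d\times d$ blocks, whose first $s-1$ block columns are zero and whose last block column has $v$-th block $\prod_{i=0}^{v-1}\phi_{v-i}(\underline{\eta}_t)=\phi_v(\underline{\eta}_t)\cdots\phi_1(\underline{\eta}_t)$, $v=1,\dots,s$. $\underline{B}(\underline{\eta}_t)\in\mathbb{R}^{ds}$ has $v$-th block $\sum_{k=1}^{v}\{\prod_{i=0}^{v-k-1}\phi_{v-i}(\underline{\eta}_t)\}\underline{B}_k(\underline{\eta}_t)$, $v=1,\dots,s$. $\|\cdot\|$ is a matrix norm (the uniform operator norm induced by the Euclidean norm; $\gamma_L$ does not depend on the choice). The infimum is over integers $t\ge1$. Causal means that $\underline{Y}_t$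 is a measurable function of $\underline{\eta}_t,\underline{\eta}_{t-1},\dots$. *)

theory Defs
  imports "HOL-Probability.Probability"
begin

section \<open>Positions in finite linearly ordered index types\<close>

text \<open>
  The integers \<open>s, p, q \<ge> 1\<close> are the cardinalities of index types \<open>'s, 'p, 'q\<close>. The linear
  order on an index type numbers its elements by \<open>1, \<dots>, CARD('n)\<close>. The space \<open>\<real>\<^sup>d\<close> with
  \<open>d = p + q\<close> is \<open>real ^ ('p + 'q)\<close>: \<open>Inl\<close> gives the first \<open>p\<close> coordinates and \<open>Inr\<close> the last
  \<open>q\<close> ones. The space \<open>\<real>\<^sup>d\<^sup>s\<close> is \<open>real ^ ('s \<times> ('p + 'q))\<close>, where \<open>(v, a)\<close> is the
  coordinate \<open>a\<close> of the block \<open>v\<close>.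
\<close>

definition position :: "'n::{finite,linorder} \<Rightarrow> nat" where
  "position i = card {..i}"

definition elt :: "nat \<Rightarrow> 'n::{finite,linorder}" where
  "elt k = (THE i. position i = k)"

lemma strict_mono_position: "strict_mono (position :: 'n::{finite,linorder} \<Rightarrow> nat)"
proof (rule strict_monoI)
  fix i j :: 'n
  assume "i < j"
  then have "{..i} \<subset> {..j}" by auto
  then show "position i < position j"
    unfolding position_def by (intro psubset_card_mono) auto
qed

lemma bij_betw_position:
  "bij_betw (position :: 'n::{finite,linorder} \<Rightarrow> nat) UNIV {1..CARD('n)}"
proof -
  let ?f = "position :: 'n \<Rightarrow> nat"
  have inj: "inj ?f"
    using strict_mono_position by (rule strict_mono_imp_inj_on)
  have "range ?f \<subseteq> {1..CARD('n)}"
    by (auto simp: position_def Suc_le_eq card_gt_0_iff intro!: card_mono)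
  moreover have "card (range ?f) = card {1..CARD('n)}"
    using inj by (simp add: card_image)
  ultimately have "range ?f = {1..CARD('n)}"
    by (intro card_subset_eq) auto
  with inj show ?thesis by (simp add: bij_betw_def)
qed

lemma elt_position [simp]: "elt (position i) = i"
  unfolding elt_def using strict_mono_position
  by (intro the_equality) (auto dest: strict_mono_eq)

lemma position_elt:
  assumes "k \<in> {1..CARD('n::{finite,linorder})}"
  shows "position (elt k :: 'n) = k"
proof -
  obtain i :: 'n where "position i = k"
    using assms bij_betw_position[where 'n = 'n] by (metis bij_betw_imp_surj_on imageE)
  then show ?thesis by auto
qed


section \<open>The matrices and vectors of the periodic GARCH model\<close>

text \<open>\<open>mat_prod a b M = M a ** M (a + 1) ** \<dots> ** M (b - 1)\<close>, with the upper bound excluded.\<close>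

definition mat_prod :: "nat \<Rightarrow> nat \<Rightarrow> (nat \<Rightarrow> real^'n^'n) \<Rightarrow> real^'n^'n" where
  "mat_prod a b M = foldr (\<lambda>i P. M i ** P) [a..<b] (mat 1)"

definition block_matrix ::
  "real^'p^'p \<Rightarrow> real^'q^'p \<Rightarrow> real^'p^'q \<Rightarrow> real^'q^'q \<Rightarrow> real^('p + 'q)^('p + 'q)" where
  "block_matrix P Q R S = (\<chi> r c.
     case r of
       Inl i \<Rightarrow> (case c of Inl k \<Rightarrow> P $ i $ k | Inr l \<Rightarrow> Q $ i $ l)
     | Inr j \<Rightarrow> (case c of Inl k \<Rightarrow> R $ j $ k | Inr l \<Rightarrow> S $ j $ l))"

text \<open>
  The coefficients \<open>\<alpha>\<^sub>i(v)\<close> and \<open>\<beta>\<^sub>j(v)\<close> are written \<open>\<alpha> i v\<close> and \<open>\<beta> j v\<close>, and \<open>\<alpha>\<^sub>0(v)\<close> is written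
  \<open>\<alpha>0 v\<close>. In what follows \<open>x :: real ^ 's\<close> stands for the vector
  \<open>(\<eta>\<^bsub>st+1\<^esub>, \<dots>, \<eta>\<^bsub>st+s\<^esub>)\<close>, and \<open>1 \<le> v \<le> s\<close>.
\<close>

definition phi ::
  "(nat \<Rightarrow> nat \<Rightarrow> real) \<Rightarrow> (nat \<Rightarrow> nat \<Rightarrow> real) \<Rightarrow> nat \<Rightarrow> real^'s::{finite,linorder}
     \<Rightarrow> real^('p::{finite,linorder} + 'q::{finite,linorder})^('p + 'q)" where
  "phi \<alpha> \<beta> v x = block_matrix
     (\<chi> i k. if position i = 1 then \<alpha> (position k) v * x $ elt v
             else if position i = position k + 1 then 1 else 0)
     (\<chi> i l. if position i = 1 then \<beta> (position l) v * x $ elt v else 0)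
     (\<chi> j k. if position j = 1 then \<alpha> (position k) v else 0)
     (\<chi> j l. if position j = 1 then \<beta> (position l) v
             else if position j = position l + 1 then 1 else 0)"

definition b_vec ::
  "(nat \<Rightarrow> real) \<Rightarrow> nat \<Rightarrow> real^'s::{finite,linorder}
     \<Rightarrow> real^('p::{finite,linorder} + 'q::{finite,linorder})" where
  "b_vec \<alpha>0 v x = (\<chi> r. case r of
       Inl i \<Rightarrow> if position i = 1 then \<alpha>0 v * x $ elt v else 0
     | Inr j \<Rightarrow> if position j = 1 then \<alpha>0 v else 0)"

definition Phi ::
  "(nat \<Rightarrow> nat \<Rightarrow> real) \<Rightarrow> (nat \<Rightarrow> nat \<Rightarrow> real) \<Rightarrow> real^'s::{finite,linorder}
     \<Rightarrow> real^('p::{finite,linorder} + 'q::{finite,linorder})^('p + 'q)" where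
  "Phi \<alpha> \<beta> x = mat_prod 0 CARD('s) (\<lambda>v. phi \<alpha> \<beta> (CARD('s) - v) x)"

definition A_mat ::
  "(nat \<Rightarrow> nat \<Rightarrow> real) \<Rightarrow> (nat \<Rightarrow> nat \<Rightarrow> real) \<Rightarrow> real^'s::{finite,linorder}
     \<Rightarrow> real^('s \<times> ('p::{finite,linorder} + 'q::{finite,linorder}))^('s \<times> ('p + 'q))" where
  "A_mat \<alpha> \<beta> x = (\<chi> r c.
     let v = position (fst r) in
     if position (fst c) = CARD('s)
     then mat_prod 0 v (\<lambda>i. phi \<alpha> \<beta> (v - i) x) $ snd r $ snd c
     else 0)"

definition B_vec ::
  "(nat \<Rightarrow> real) \<Rightarrow> (nat \<Rightarrow> nat \<Rightarrow> real) \<Rightarrow> (nat \<Rightarrow> nat \<Rightarrow> real) \<Rightarrow> real^'s::{finite,linorder}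
     \<Rightarrow> real^('s \<times> ('p::{finite,linorder} + 'q::{finite,linorder}))" where
  "B_vec \<alpha>0 \<alpha> \<beta> x = (\<chi> r.
     let v = position (fst r) in
     (\<Sum>k = 1..v. mat_prod 0 (v - k) (\<lambda>i. phi \<alpha> \<beta> (v - i) x) *v b_vec \<alpha>0 k x) $ snd r)"

definition series_term ::
  "(nat \<Rightarrow> real) \<Rightarrow> (nat \<Rightarrow> nat \<Rightarrow> real) \<Rightarrow> (nat \<Rightarrow> nat \<Rightarrow> real)
     \<Rightarrow> (int \<Rightarrow> 'a \<Rightarrow> real^'s::{finite,linorder}) \<Rightarrow> int \<Rightarrow> 'a \<Rightarrow> nat
     \<Rightarrow> real^('s \<times> ('p::{finite,linorder} + 'q::{finite,linorder}))" where
  "series_term \<alpha>0 \<alpha> \<beta> \<eta> t \<omega> k =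
     mat_prod 0 k (\<lambda>j. A_mat \<alpha> \<beta> (\<eta> (t - int j) \<omega>)) *v B_vec \<alpha>0 \<alpha> \<beta> (\<eta> (t - int k) \<omega>)"


section \<open>The top Lyapunov exponent\<close>

text \<open>
  The norm of a product of the matrices may vanish with positive probability, and
  \<open>ln 0 = 0\<close> for the real logarithm, hence the logarithm and the expectation are taken in
  the extended reals. The expectation below is the usual one whenever the positive or the
  negative part has finite expectation, and \<open>\<infinity>\<close> otherwise, since \<open>\<infinity> - \<infinity> = \<infinity>\<close> in \<^typ>\<open>ereal\<close>.
\<close>

definition log_ext :: "real \<Rightarrow> ereal" where
  "log_ext x = (if x = 0 then -\<infinity> else ereal (ln x))"

definition expectation_ext :: "'a measure \<Rightarrow> ('a \<Rightarrow> ereal) \<Rightarrow> ereal" where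
  "expectation_ext M X =
     enn2ereal (\<integral>\<^sup>+ \<omega>. e2ennreal (X \<omega>) \<partial>M) - enn2ereal (\<integral>\<^sup>+ \<omega>. e2ennreal (- X \<omega>) \<partial>M)"

definition top_lyapunov :: "'a measure \<Rightarrow> (int \<Rightarrow> 'a \<Rightarrow> real^'n^'n) \<Rightarrow> ereal" where
  "top_lyapunov M X = (INF t\<in>{1::nat..}.
     expectation_ext M (\<lambda>\<omega>. ereal (1 / real t) *
       log_ext (onorm ((*v) (mat_prod 1 (Suc t) (\<lambda>i. X (int t - int i) \<omega>))))))"


section \<open>Strictly stationary, causal and ergodic solutions\<close>

definition strictly_stationary ::
  "'a measure \<Rightarrow> (int \<Rightarrow> 'a \<Rightarrow> 'b::topological_space) \<Rightarrow> bool" where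
  "strictly_stationary M Y \<longleftrightarrow>
     (\<forall>t. Y t \<in> borel_measurable M) \<and>
     (\<forall>J h. finite J \<longrightarrow>
        distr M (Pi\<^sub>M J (\<lambda>_. borel)) (\<lambda>\<omega>. \<lambda>j\<in>J. Y (j + h) \<omega>) =
        distr M (Pi\<^sub>M J (\<lambda>_. borel)) (\<lambda>\<omega>. \<lambda>j\<in>J. Y j \<omega>))"

definition causal ::
  "'a measure \<Rightarrow> (int \<Rightarrow> 'a \<Rightarrow> 'c::topological_space) \<Rightarrow> (int \<Rightarrow> 'a \<Rightarrow> 'b::topological_space)
     \<Rightarrow> bool" where
  "causal M \<eta> Y \<longleftrightarrow>
     (\<forall>t. \<exists>f \<in> borel_measurable (Pi\<^sub>M (UNIV :: nat set) (\<lambda>_. borel)).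
        \<forall>\<omega>\<in>space M. Y t \<omega> = f (\<lambda>k. \<eta> (t - int k) \<omega>))"

text \<open>Every shift-invariant event of the path space has probability 0 or 1.\<close>

definition ergodic_process ::
  "'a measure \<Rightarrow> (int \<Rightarrow> 'a \<Rightarrow> 'b::topological_space) \<Rightarrow> bool" where
  "ergodic_process M Y \<longleftrightarrow>
     (\<forall>S \<in> sets (Pi\<^sub>M (UNIV :: int set) (\<lambda>_. borel)).
        (\<lambda>y t. y (t + 1)) -` S = S \<longrightarrow>
        measure M {\<omega> \<in> space M. (\<lambda>t. Y t \<omega>) \<in> S} \<in> {0, 1})"

definition stationary_causal_ergodic_solution ::
  "'a measure \<Rightarrow> (nat \<Rightarrow> real) \<Rightarrow> (nat \<Rightarrow> nat \<Rightarrow> real) \<Rightarrow> (nat \<Rightarrow> nat \<Rightarrow> real)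
     \<Rightarrow> (int \<Rightarrow> 'a \<Rightarrow> real^'s::{finite,linorder})
     \<Rightarrow> (int \<Rightarrow> 'a \<Rightarrow> real^('s \<times> ('p::{finite,linorder} + 'q::{finite,linorder}))) \<Rightarrow> bool" where
  "stationary_causal_ergodic_solution M \<alpha>0 \<alpha> \<beta> \<eta> Y \<longleftrightarrow>
     strictly_stationary M Y \<and> causal M \<eta> Y \<and> ergodic_process M Y \<and>
     (\<forall>t. AE \<omega> in M.
        Y t \<omega> = A_mat \<alpha> \<beta> (\<eta> t \<omega>) *v Y (t - 1) \<omega> + B_vec \<alpha>0 \<alpha> \<beta> (\<eta> t \<omega>))"

end

theory Submission
  imports Defs
begin

text \<open>
  The proof replaces the law of large numbers by moments of a small order. The entries of \<open>Phi\<close>,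
  \<open>A_mat\<close> and \<open>B_vec\<close> are bounded by a product of affine functions of the squared innovations of one
  period, which are independent with mean 1, hence the norms are integrable (lemma \<open>period_bound\<close>).
  If the top Lyapunov exponent is negative, then for some \<open>N\<close> the norm \<open>W\<close> of a product of \<open>N\<close>
  consecutive matrices \<open>Phi\<close> satisfies \<open>E log W < 0\<close>. Since \<open>W\<close> is integrable, \<open>E W\<^sup>\<delta> < 1\<close> for some
  \<open>\<delta> \<in> (0, 1]\<close> (lemma \<open>power_mean_less_1\<close>). By independence the moments of order \<open>\<delta>\<close> of the norms of
  products are submultiplicative in the length, and so they are summable (lemma \<open>summable_moments\<close>).

  The matrix \<open>A_mat\<close> factors through the last block, on which it acts as \<open>Phi\<close>. The moments of order
  \<open>\<delta>\<close> of the terms of the series are therefore summable as well, and the series converges absolutely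
  almost surely. Splitting off its first term shows that it solves the recursion. Its value at time
  \<open>t\<close> is one fixed measurable function of the innovations up to time \<open>t\<close>, so it is causal and inherits
  strict stationarity and ergodicity from the i.i.d. sequence; ergodicity of the latter follows from
  mixing (lemma \<open>invariant_event_trivial\<close>). For uniqueness, the difference of two stationary solutions
  at time \<open>t\<close> is a product of \<open>k\<close> matrices \<open>A_mat\<close>, which tends to 0 almost surely, applied to the
  difference at time \<open>t - k\<close>, which is bounded in probability uniformly in \<open>k\<close>
  (lemma \<open>AE_solution_unique\<close>).
\<close>

section \<open>Two-sided independent and identically distributed sequences\<close>

lemma (in prob_space) indep_var_nn_integral:
  fixes X Y :: "'a \<Rightarrow> ennreal"
  assumes "indep_var borel X borel Y"
  shows "(\<integral>\<^sup>+\<omega>. X \<omega> * Y \<omega> \<partial>M) = (\<integral>\<^sup>+\<omega>. X \<omega> \<partial>M) * (\<integral>\<^sup>+\<omega>. Y \<omega> \<partial>M)"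
proof -
  have "case_bool borel borel = (\<lambda>_. borel :: ennreal measure)"
    by (auto split: bool.split)
  then have "indep_vars (\<lambda>_. borel) (case_bool X Y) UNIV"
    using assms by (simp add: indep_var_def)
  then have "(\<integral>\<^sup>+\<omega>. (\<Prod>b\<in>UNIV. case_bool X Y b \<omega>) \<partial>M) = (\<Prod>b\<in>UNIV. \<integral>\<^sup>+\<omega>. case_bool X Y b \<omega> \<partial>M)"
    by (intro indep_vars_nn_integral) auto
  then show ?thesis
    by (simp add: UNIV_bool mult.commute)
qed

abbreviation path_space :: "(int \<Rightarrow> 'b::topological_space) measure" where
  "path_space \<equiv> Pi\<^sub>M UNIV (\<lambda>_. borel)"

text \<open>A function of a two-sided path that only looks at the coordinates in \<open>A\<close>.\<close>

definition depends_on :: "int set \<Rightarrow> ((int \<Rightarrow> 'b) \<Rightarrow> 'c) \<Rightarrow> bool" where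
  "depends_on A f \<longleftrightarrow> (\<forall>y y'. (\<forall>i\<in>A. y i = y' i) \<longrightarrow> f y = f y')"

lemma depends_on_comp: "depends_on A f \<Longrightarrow> depends_on A (\<lambda>y. g (f y))"
  unfolding depends_on_def by (intro allI impI arg_cong[where f = g]) blast

lemma measurable_shift:
  "(\<lambda>y t. y (t + h)) \<in> path_space \<rightarrow>\<^sub>M (path_space :: (int \<Rightarrow> 'b::topological_space) measure)"
  by (rule measurable_PiM_single') auto

text \<open>
  A family with index set \<open>C\<close> is a two-sided path that takes the default value outside \<open>C\<close>.
\<close>

lemma measurable_PiM_inclusion:
  "(\<lambda>z. z) \<in> Pi\<^sub>M C (\<lambda>_. borel) \<rightarrow>\<^sub>M (path_space :: (int \<Rightarrow> 'b::topological_space) measure)"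
proof (rule measurable_PiM_single')
  fix i :: int
  show "(\<lambda>z. z i) \<in> Pi\<^sub>M C (\<lambda>_. borel) \<rightarrow>\<^sub>M (borel :: 'b measure)"
  proof (cases "i \<in> C")
    case False
    have "(\<lambda>z. z i) \<in> Pi\<^sub>M C (\<lambda>_. borel) \<rightarrow>\<^sub>M (borel :: 'b measure) \<longleftrightarrow>
        (\<lambda>z. undefined) \<in> Pi\<^sub>M C (\<lambda>_. borel :: 'b measure) \<rightarrow>\<^sub>M (borel :: 'b measure)"
      by (intro measurable_cong) (use False in \<open>auto simp: space_PiM intro: PiE_arb\<close>)
    then show ?thesis by simp
  qed (rule measurable_component_singleton)
qed auto

text \<open>An i.i.d. sequence of random elements of a topological space, indexed by the integers.\<close>

locale iid_process = prob_space M for M :: "'a measure" +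
  fixes \<eta> :: "int \<Rightarrow> 'a \<Rightarrow> 'b::topological_space"
  assumes indep: "indep_vars (\<lambda>_. borel) \<eta> UNIV"
    and ident: "\<And>t. distr M borel (\<eta> t) = distr M borel (\<eta> 0)"
begin

lemma rv [measurable]: "\<eta> t \<in> borel_measurable M"
  using indep unfolding indep_vars_def by blast

abbreviation (input) path :: "'a \<Rightarrow> int \<Rightarrow> 'b" where
  "path \<omega> \<equiv> (\<lambda>t. \<eta> t \<omega>)"

lemma measurable_path_shift: "(\<lambda>\<omega> t. \<eta> (t + h) \<omega>) \<in> M \<rightarrow>\<^sub>M path_space"
proof (rule measurable_PiM_single')
  show "\<eta> (t + h) \<in> borel_measurable M" for t by (rule rv)
qed auto

lemma measurable_path: "path \<in> M \<rightarrow>\<^sub>M path_space"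
proof (rule measurable_PiM_single')
  show "\<eta> t \<in> borel_measurable M" for t by (rule rv)
qed auto

text \<open>The law of every shift of the path is the same product measure.\<close>

lemma path_law:
  "distr M path_space (\<lambda>\<omega> t. \<eta> (t + h) \<omega>) = Pi\<^sub>M UNIV (\<lambda>_. distr M borel (\<eta> 0))"
proof -
  let ?D = "distr M borel (\<eta> 0)"
  let ?P = "Pi\<^sub>M UNIV (\<lambda>_::int. ?D)"
  have "distr M path_space (\<lambda>\<omega>. \<lambda>t\<in>UNIV. \<eta> t \<omega>) = Pi\<^sub>M UNIV (\<lambda>t. distr M borel (\<eta> t))"
    by (rule indep_vars_iff_distr_eq_PiM'[THEN iffD1, OF _ rv indep]) simp
  moreover have law: "(\<lambda>t. distr M borel (\<eta> t)) = (\<lambda>_. ?D)"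
    using ident by (rule ext)
  ultimately have 0: "distr M path_space path = ?P"
    unfolding law by (simp add: restrict_UNIV)
  have "distr M path_space (\<lambda>\<omega> t. \<eta> (t + h) \<omega>) = distr (distr M path_space path) path_space (\<lambda>y t. y (t + h))"
    by (subst distr_distr) (auto simp: comp_def measurable_shift measurable_path)
  also have "\<dots> = distr ?P ?P (\<lambda>y. \<lambda>t\<in>UNIV. y (t + h))"
    unfolding 0 by (intro distr_cong) (auto intro!: sets_PiM_cong)
  also have "\<dots> = ?P"
  proof (rule distr_PiM_reindex[of UNIV "\<lambda>_. ?D" "\<lambda>t. t + h" UNIV])
    show "prob_space ?D" by (rule prob_space_distr[OF rv])
  qed (simp_all add: inj_def)
  finally show ?thesis .
qed

lemma path_law_shift:
  "distr M path_space (\<lambda>\<omega> t. \<eta> (t + h) \<omega>) = distr M path_space path"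
  by (rule trans[OF path_law path_law[of 0, unfolded add_0_right, symmetric]])

lemma nn_integral_shift:
  assumes f: "f \<in> borel_measurable path_space"
  shows "(\<integral>\<^sup>+\<omega>. f (\<lambda>t. \<eta> (t + h) \<omega>) \<partial>M) = (\<integral>\<^sup>+\<omega>. f (path \<omega>) \<partial>M)"
proof -
  have "(\<integral>\<^sup>+\<omega>. f (\<lambda>t. \<eta> (t + h) \<omega>) \<partial>M) = (\<integral>\<^sup>+y. f y \<partial>distr M path_space (\<lambda>\<omega> t. \<eta> (t + h) \<omega>))"
    by (rule nn_integral_distr[symmetric, OF measurable_path_shift]) (simp add: f)
  also have "\<dots> = (\<integral>\<^sup>+y. f y \<partial>distr M path_space path)"
    by (simp only: path_law_shift[of h])
  also have "\<dots> = (\<integral>\<^sup>+\<omega>. f (path \<omega>) \<partial>M)"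
    by (rule nn_integral_distr[OF measurable_path]) (simp add: f)
  finally show ?thesis .
qed

text \<open>Functions of disjoint sets of coordinates are independent.\<close>

lemma nn_integral_disjoint:
  fixes f g :: "(int \<Rightarrow> 'b) \<Rightarrow> ennreal"
  assumes meas: "f \<in> borel_measurable path_space" "g \<in> borel_measurable path_space"
    and f: "depends_on A f" and g: "depends_on B g" and AB: "A \<inter> B = {}"
  shows "(\<integral>\<^sup>+\<omega>. f (path \<omega>) * g (path \<omega>) \<partial>M)
    = (\<integral>\<^sup>+\<omega>. f (path \<omega>) \<partial>M) * (\<integral>\<^sup>+\<omega>. g (path \<omega>) \<partial>M)"
proof -
  have "indep_var (Pi\<^sub>M A (\<lambda>_. borel)) (\<lambda>\<omega>. restrict (path \<omega>) A)
      (Pi\<^sub>M B (\<lambda>_. borel)) (\<lambda>\<omega>. restrict (path \<omega>) B)"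
    by (rule indep_var_restrict[OF indep AB]) auto
  then have "indep_var borel (f \<circ> (\<lambda>\<omega>. restrict (path \<omega>) A)) borel (g \<circ> (\<lambda>\<omega>. restrict (path \<omega>) B))"
  proof (rule indep_var_compose)
    show "f \<in> Pi\<^sub>M A (\<lambda>_. borel) \<rightarrow>\<^sub>M borel"
      by (rule measurable_compose[OF measurable_PiM_inclusion meas(1)])
    show "g \<in> Pi\<^sub>M B (\<lambda>_. borel) \<rightarrow>\<^sub>M borel"
      by (rule measurable_compose[OF measurable_PiM_inclusion meas(2)])
  qed
  moreover have "f (restrict (path \<omega>) A) = f (path \<omega>)" "g (restrict (path \<omega>) B) = g (path \<omega>)" for \<omega>
    using f g by (auto simp: depends_on_def)
  ultimately have "indep_var borel (\<lambda>\<omega>. f (path \<omega>)) borel (\<lambda>\<omega>. g (path \<omega>))"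
    by (simp add: comp_def)
  then show ?thesis by (rule indep_var_nn_integral)
qed

lemma path_event [simp]:
  assumes "S \<in> sets path_space"
  shows "{\<omega>\<in>space M. path \<omega> \<in> S} \<in> events"
    and "{\<omega>\<in>space M. (\<lambda>t. \<eta> (t + h) \<omega>) \<in> S} \<in> events"
  using measurable_sets[OF measurable_path assms] measurable_sets[OF measurable_path_shift[of h] assms]
  by (simp_all add: vimage_def Int_def conj_commute)

lemma prob_path_shift:
  assumes [measurable]: "S \<in> sets path_space"
  shows "prob {\<omega>\<in>space M. (\<lambda>t. \<eta> (t + h) \<omega>) \<in> S} = prob {\<omega>\<in>space M. path \<omega> \<in> S}"
proof -
  have "measure (distr M path_space (\<lambda>\<omega> t. \<eta> (t + h) \<omega>)) S = measure (distr M path_space path) S"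
    by (simp only: path_law_shift[of h])
  then show ?thesis
    using assms by (simp add: measure_distr measurable_path measurable_path_shift vimage_def Int_def conj_commute)
qed

lemma prob_disjoint:
  assumes [measurable]: "S \<in> sets path_space" "T \<in> sets path_space"
    and S: "depends_on A (\<lambda>y. y \<in> S)" and T: "depends_on B (\<lambda>y. y \<in> T)" and AB: "A \<inter> B = {}"
  shows "prob {\<omega>\<in>space M. path \<omega> \<in> S \<and> path \<omega> \<in> T}
    = prob {\<omega>\<in>space M. path \<omega> \<in> S} * prob {\<omega>\<in>space M. path \<omega> \<in> T}"
proof -
  have *: "(\<integral>\<^sup>+\<omega>. indicator R (path \<omega>) \<partial>M) = ennreal (prob {\<omega>\<in>space M. path \<omega> \<in> R})"
    if [measurable]: "R \<in> sets path_space" for R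
  proof -
    have "(\<integral>\<^sup>+\<omega>. indicator R (path \<omega>) \<partial>M) = (\<integral>\<^sup>+\<omega>. indicator {\<omega>\<in>space M. path \<omega> \<in> R} \<omega> \<partial>M)"
      by (intro nn_integral_cong) (auto simp: indicator_def)
    then show ?thesis by (simp add: emeasure_eq_measure)
  qed
  have "depends_on A (indicator S :: _ \<Rightarrow> ennreal)" "depends_on B (indicator T :: _ \<Rightarrow> ennreal)"
    using depends_on_comp[OF S, of of_bool] depends_on_comp[OF T, of of_bool]
    by (simp_all add: indicator_def[abs_def])
  then have "(\<integral>\<^sup>+\<omega>. indicator S (path \<omega>) * indicator T (path \<omega>) \<partial>M)
      = (\<integral>\<^sup>+\<omega>. indicator S (path \<omega>) \<partial>M) * (\<integral>\<^sup>+\<omega>. indicator T (path \<omega>) \<partial>M)"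
    using AB by (intro nn_integral_disjoint) auto
  moreover have "indicator S y * indicator T y = (indicator (S \<inter> T) y :: ennreal)" for y
    by (auto simp: indicator_def)
  ultimately have "ennreal (prob {\<omega>\<in>space M. path \<omega> \<in> S \<inter> T})
      = ennreal (prob {\<omega>\<in>space M. path \<omega> \<in> S} * prob {\<omega>\<in>space M. path \<omega> \<in> T})"
    by (simp add: * ennreal_mult)
  then show ?thesis by simp
qed

text \<open>The sets in the intersection-stable generator of the product depend on finitely many coordinates.\<close>

lemma cylinder:
  assumes "C \<in> prod_algebra UNIV (\<lambda>_::int. borel :: 'b measure)"
  obtains J where "finite J" "depends_on J (\<lambda>y. y \<in> C)" "C \<in> sets path_space"
proof -
  from assms obtain J E where J: "C = prod_emb UNIV (\<lambda>_. borel) J (Pi\<^sub>E J E)" "finite J"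
      "\<And>j. j \<in> J \<Longrightarrow> E j \<in> sets borel"
    by (rule prod_algebraE) blast
  have "y \<in> C \<longleftrightarrow> (\<forall>j\<in>J. y j \<in> E j)" for y
    unfolding J(1) by (auto simp: prod_emb_def PiE_iff)
  then have "depends_on J (\<lambda>y. y \<in> C)" by (auto simp: depends_on_def)
  moreover have "C \<in> sets path_space"
    using assms by (auto simp: sets_PiM intro: sigma_sets.Basic)
  ultimately show ?thesis using J(2) that by blast
qed

text \<open>
  Mixing: a cylinder is asymptotically independent of the remote shifts of any event. For a fixed
  cylinder the events with this property form a Dynkin class, which contains the cylinders, since
  remote shifts of a finite set of coordinates are disjoint from a given one.
\<close>

lemma mixing_cylinder:
  assumes C: "C \<in> prod_algebra UNIV (\<lambda>_::int. borel :: 'b measure)" and S: "S \<in> sets path_space"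
  shows "(\<lambda>n. prob {\<omega>\<in>space M. path \<omega> \<in> C \<and> (\<lambda>t. \<eta> (t + int n) \<omega>) \<in> S})
    \<longlonglongrightarrow> prob {\<omega>\<in>space M. path \<omega> \<in> C} * prob {\<omega>\<in>space M. path \<omega> \<in> S}"
proof -
  obtain J where J: "finite J" "depends_on J (\<lambda>y. y \<in> C)" and C' [measurable]: "C \<in> sets path_space"
    using C by (rule cylinder)
  let ?X = "\<Pi>\<^sub>E i\<in>(UNIV::int set). space (borel :: 'b measure)"
  have gen: "sets path_space = sigma_sets ?X (prod_algebra UNIV (\<lambda>_. borel :: 'b measure))"
    by (rule sets_PiM)
  have pw: "prod_algebra UNIV (\<lambda>_. borel :: 'b measure) \<subseteq> Pow ?X"
    by (rule prod_algebra_sets_into_space)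
  have "S \<in> sigma_sets ?X (prod_algebra UNIV (\<lambda>_. borel :: 'b measure))"
    using S gen by simp
  from Int_stable_prod_algebra pw this show ?thesis
  proof (induction rule: sigma_sets_induct_disjoint)
    case (basic D)
    obtain K where K: "finite K" "depends_on K (\<lambda>y. y \<in> D)" and D [measurable]: "D \<in> sets path_space"
      using basic by (rule cylinder)
    define N where "N = 1 + (\<Sum>i\<in>J \<union> K. \<bar>i\<bar>)"
    have N: "\<bar>i\<bar> < N" if "i \<in> J \<union> K" for i
      using member_le_sum[of i "J \<union> K" "\<lambda>i. \<bar>i\<bar>"] that J(1) K(1) by (auto simp: N_def)
    have "prob {\<omega>\<in>space M. path \<omega> \<in> C \<and> (\<lambda>t. \<eta> (t + int n) \<omega>) \<in> D}
        = prob {\<omega>\<in>space M. path \<omega> \<in> C} * prob {\<omega>\<in>space M. path \<omega> \<in> D}" if "int n \<ge> 2 * N" for n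
    proof -
      let ?D = "(\<lambda>y t. y (t + int n)) -` D"
      have D' [measurable]: "?D \<in> sets path_space"
        using measurable_sets[OF measurable_shift D] by (simp add: space_PiM)
      have "prob {\<omega>\<in>space M. path \<omega> \<in> C \<and> path \<omega> \<in> ?D}
          = prob {\<omega>\<in>space M. path \<omega> \<in> C} * prob {\<omega>\<in>space M. path \<omega> \<in> ?D}"
      proof (rule prob_disjoint)
        show "depends_on ((\<lambda>i. i + int n) ` K) (\<lambda>y. y \<in> ?D)"
          using K(2) by (auto simp: depends_on_def)
        show "J \<inter> (\<lambda>i. i + int n) ` K = {}"
        proof (intro equals0I)
          fix i assume "i \<in> J \<inter> (\<lambda>i. i + int n) ` K"
          then obtain j where "i \<in> J" "j \<in> K" "i = j + int n" by auto
          then show False using N[of i] N[of j] that by auto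
        qed
      qed (use J C' in auto)
      moreover have "prob {\<omega>\<in>space M. path \<omega> \<in> ?D} = prob {\<omega>\<in>space M. path \<omega> \<in> D}"
        using prob_path_shift[OF D, of "int n"] by simp
      ultimately show ?thesis by simp
    qed
    then show ?case
      by (intro tendsto_eventually eventually_sequentiallyI[of "nat (2 * N)"]) auto
  next
    case empty
    then show ?case by simp
  next
    case (compl D)
    then have D [measurable]: "D \<in> sets path_space" by (simp add: gen)
    have 1: "prob {\<omega>\<in>space M. path \<omega> \<in> C \<and> (\<lambda>t. \<eta> (t + int n) \<omega>) \<in> ?X - D}
        = prob {\<omega>\<in>space M. path \<omega> \<in> C} - prob {\<omega>\<in>space M. path \<omega> \<in> C \<and> (\<lambda>t. \<eta> (t + int n) \<omega>) \<in> D}" for n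
      by (subst finite_measure_Diff[symmetric]) (auto intro!: arg_cong[where f = prob] sets.sets_Collect_conj)
    have 2: "prob {\<omega>\<in>space M. path \<omega> \<in> ?X - D} = 1 - prob {\<omega>\<in>space M. path \<omega> \<in> D}"
      by (subst prob_compl[symmetric]) (auto intro!: arg_cong[where f = prob] sets.sets_Collect_conj)
    show ?case
      unfolding 1 2 using compl(2) by (auto intro!: tendsto_eq_intros simp: algebra_simps)
  next
    case (union D)
    then have D [measurable]: "D i \<in> sets path_space" for i by (auto simp: gen)
    define a where "a i n = prob {\<omega>\<in>space M. path \<omega> \<in> C \<and> (\<lambda>t. \<eta> (t + int n) \<omega>) \<in> D i}" for i n
    define b where "b i = prob {\<omega>\<in>space M. path \<omega> \<in> D i}" for i
    have b: "b sums prob {\<omega>\<in>space M. path \<omega> \<in> (\<Union>i. D i)}"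
    proof -
      have "(\<lambda>i. prob {\<omega>\<in>space M. path \<omega> \<in> D i}) sums prob (\<Union>i. {\<omega>\<in>space M. path \<omega> \<in> D i})"
        using union(1) by (intro finite_measure_UNION) (auto simp: disjoint_family_on_def intro!: sets.sets_Collect_conj)
      moreover have "(\<Union>i. {\<omega>\<in>space M. path \<omega> \<in> D i}) = {\<omega>\<in>space M. path \<omega> \<in> (\<Union>i. D i)}" by auto
      ultimately show ?thesis by (simp add: b_def[abs_def])
    qed
    have a: "(\<lambda>i. a i n) sums prob {\<omega>\<in>space M. path \<omega> \<in> C \<and> (\<lambda>t. \<eta> (t + int n) \<omega>) \<in> (\<Union>i. D i)}" for n
    proof -
      have "(\<lambda>i. a i n) sums prob (\<Union>i. {\<omega>\<in>space M. path \<omega> \<in> C \<and> (\<lambda>t. \<eta> (t + int n) \<omega>) \<in> D i})"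
        unfolding a_def using union(1) by (intro finite_measure_UNION) (auto simp: disjoint_family_on_def intro!: sets.sets_Collect_conj)
      moreover have "(\<Union>i. {\<omega>\<in>space M. path \<omega> \<in> C \<and> (\<lambda>t. \<eta> (t + int n) \<omega>) \<in> D i})
          = {\<omega>\<in>space M. path \<omega> \<in> C \<and> (\<lambda>t. \<eta> (t + int n) \<omega>) \<in> (\<Union>i. D i)}" by auto
      ultimately show ?thesis by simp
    qed
    have le: "norm (a i n) \<le> b i" for i n
    proof -
      have "a i n \<le> prob {\<omega>\<in>space M. (\<lambda>t. \<eta> (t + int n) \<omega>) \<in> D i}"
        unfolding a_def by (intro finite_measure_mono) auto
      then show ?thesis
        using prob_path_shift[OF D[of i], of "int n"] by (simp add: b_def a_def)
    qed
    \<comment> \<open>The limit and the sum may be exchanged, as shift invariance bounds the summands uniformly in \<open>n\<close>.\<close>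
    have "((\<lambda>n. \<Sum>i. a i n) \<longlonglongrightarrow> (\<Sum>i. prob {\<omega>\<in>space M. path \<omega> \<in> C} * b i))"
    proof (rule tannerys_theorem[THEN conjunct2, THEN conjunct2])
      show "(\<lambda>n. a i n) \<longlonglongrightarrow> prob {\<omega>\<in>space M. path \<omega> \<in> C} * b i" for i
        unfolding a_def b_def by (rule union(3)) 
      show "\<forall>\<^sub>F (k, n) in at_top \<times>\<^sub>F sequentially. norm (a k n) \<le> b k"
        using le by (auto intro!: always_eventually)
      show "summable b" using b by (rule sums_summable)
    qed simp
    then show ?case
      using a b by (simp add: sums_iff suminf_mult)
  qed
qed

text \<open>
  An invariant event \<open>S\<close> equals its remote shifts, so by mixing it is independent of every cylinder,
  hence of every event and in particular of itself.
\<close>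

lemma invariant_event_trivial:
  assumes S [measurable]: "S \<in> sets path_space" and inv: "(\<lambda>y t. y (t + 1)) -` S = S"
  shows "prob {\<omega>\<in>space M. path \<omega> \<in> S} \<in> {0, 1}"
proof -
  have inv': "(\<lambda>t. y (t + int n)) \<in> S \<longleftrightarrow> y \<in> S" for y :: "int \<Rightarrow> 'b" and n
  proof (induction n arbitrary: y)
    case (Suc n)
    have "(\<lambda>t. y (t + int (Suc n))) = (\<lambda>t. (\<lambda>u. y (u + 1)) (t + int n))"
      by (auto simp: algebra_simps)
    then have "(\<lambda>t. y (t + int (Suc n))) \<in> S \<longleftrightarrow> (\<lambda>u. y (u + 1)) \<in> S"
      using Suc[of "\<lambda>u. y (u + 1)"] by simp
    also have "\<dots> \<longleftrightarrow> y \<in> S" using inv by auto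
    finally show ?case .
  qed simp
  let ?p = "\<lambda>C. prob {\<omega>\<in>space M. path \<omega> \<in> C}"
  let ?X = "\<Pi>\<^sub>E i\<in>(UNIV::int set). space (borel :: 'b measure)"
  have gen: "sets path_space = sigma_sets ?X (prod_algebra UNIV (\<lambda>_. borel :: 'b measure))"
    by (rule sets_PiM)
  have pw: "prod_algebra UNIV (\<lambda>_. borel :: 'b measure) \<subseteq> Pow ?X"
    by (rule prod_algebra_sets_into_space)
  have "C \<in> sigma_sets ?X (prod_algebra UNIV (\<lambda>_. borel :: 'b measure)) \<Longrightarrow>
      prob {\<omega>\<in>space M. path \<omega> \<in> C \<and> path \<omega> \<in> S} = ?p C * ?p S" for C
  proof -
    assume "C \<in> sigma_sets ?X (prod_algebra UNIV (\<lambda>_. borel :: 'b measure))"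
    from Int_stable_prod_algebra pw this show ?thesis
    proof (induction rule: sigma_sets_induct_disjoint)
      case (basic C)
      have "(\<lambda>n. prob {\<omega>\<in>space M. path \<omega> \<in> C \<and> path \<omega> \<in> S}) \<longlonglongrightarrow> ?p C * ?p S"
        using mixing_cylinder[OF basic S] inv'[of "path _"] by simp
      then show ?case by (simp add: LIMSEQ_const_iff)
    next
      case empty
      then show ?case by simp
    next
      case (compl D)
      then have D [measurable]: "D \<in> sets path_space" by (simp add: gen)
      have 1: "prob {\<omega>\<in>space M. path \<omega> \<in> ?X - D \<and> path \<omega> \<in> S}
          = ?p S - prob {\<omega>\<in>space M. path \<omega> \<in> D \<and> path \<omega> \<in> S}"
        by (subst finite_measure_Diff[symmetric]) (auto intro!: arg_cong[where f = prob] sets.sets_Collect_conj)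
      have 2: "?p (?X - D) = 1 - ?p D"
        by (subst prob_compl[symmetric]) (auto intro!: arg_cong[where f = prob] sets.sets_Collect_conj)
      show ?case
        unfolding 1 2 using compl(2) by (simp add: algebra_simps)
    next
      case (union D)
      then have D [measurable]: "D i \<in> sets path_space" for i by (auto simp: gen)
      have "(\<lambda>i. ?p (D i)) sums prob (\<Union>i. {\<omega>\<in>space M. path \<omega> \<in> D i})"
        using union(1) by (intro finite_measure_UNION) (auto simp: disjoint_family_on_def intro!: sets.sets_Collect_conj)
      moreover have "(\<Union>i. {\<omega>\<in>space M. path \<omega> \<in> D i}) = {\<omega>\<in>space M. path \<omega> \<in> (\<Union>i. D i)}" by auto
      ultimately have 1: "(\<lambda>i. ?p (D i) * ?p S) sums (?p (\<Union>i. D i) * ?p S)"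
        by (auto intro: sums_mult2)
      have "(\<lambda>i. prob {\<omega>\<in>space M. path \<omega> \<in> D i \<and> path \<omega> \<in> S}) sums
          prob (\<Union>i. {\<omega>\<in>space M. path \<omega> \<in> D i \<and> path \<omega> \<in> S})"
        using union(1) by (intro finite_measure_UNION) (auto simp: disjoint_family_on_def intro!: sets.sets_Collect_conj)
      moreover have "(\<Union>i. {\<omega>\<in>space M. path \<omega> \<in> D i \<and> path \<omega> \<in> S})
          = {\<omega>\<in>space M. path \<omega> \<in> (\<Union>i. D i) \<and> path \<omega> \<in> S}" by auto
      ultimately show ?case
        using 1 union(3) by (simp add: sums_unique2)
    qed
  qed
  from this[of S] have "?p S = ?p S * ?p S"
    using S gen by simp
  then show ?thesis by auto
qed

text \<open>
  A process obtained from \<open>\<eta>\<close> by one measurable function of the shifted path is strictly stationary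
  and ergodic.
\<close>

lemma strictly_stationary_factor:
  fixes Z :: "int \<Rightarrow> 'a \<Rightarrow> 'c::topological_space"
  assumes f: "f \<in> borel_measurable path_space"
    and Z: "\<And>t \<omega>. Z t \<omega> = f (\<lambda>k. \<eta> (k + t) \<omega>)"
  shows "strictly_stationary M Z"
  unfolding strictly_stationary_def
proof (intro conjI allI impI)
  show "Z t \<in> borel_measurable M" for t
    unfolding Z[abs_def] by (rule measurable_compose[OF measurable_path_shift f])
  fix J :: "int set" and h :: int
  let ?F = "\<lambda>y. \<lambda>j\<in>J. f (\<lambda>k. y (k + j))"
  have F: "?F \<in> path_space \<rightarrow>\<^sub>M Pi\<^sub>M J (\<lambda>_. borel)"
    by (intro measurable_restrict measurable_compose[OF measurable_shift f])
  have "distr M (Pi\<^sub>M J (\<lambda>_. borel)) (\<lambda>\<omega>. \<lambda>j\<in>J. Z (j + h) \<omega>)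
      = distr (distr M path_space (\<lambda>\<omega> t. \<eta> (t + h) \<omega>)) (Pi\<^sub>M J (\<lambda>_. borel)) ?F" for h
    using F by (subst distr_distr) (auto simp: comp_def Z algebra_simps measurable_path_shift)
  from this[of h] this[of 0] show "distr M (Pi\<^sub>M J (\<lambda>_. borel)) (\<lambda>\<omega>. \<lambda>j\<in>J. Z (j + h) \<omega>)
      = distr M (Pi\<^sub>M J (\<lambda>_. borel)) (\<lambda>\<omega>. \<lambda>j\<in>J. Z j \<omega>)"
    by (simp add: path_law_shift)
qed

lemma ergodic_factor:
  fixes Z :: "int \<Rightarrow> 'a \<Rightarrow> 'c::topological_space"
  assumes f: "f \<in> borel_measurable path_space"
    and Z: "\<And>t \<omega>. Z t \<omega> = f (\<lambda>k. \<eta> (k + t) \<omega>)"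
  shows "ergodic_process M Z"
  unfolding ergodic_process_def
proof (intro ballI impI)
  fix S :: "(int \<Rightarrow> 'c) set"
  assume S: "S \<in> sets path_space" and inv: "(\<lambda>y t. y (t + 1)) -` S = S"
  let ?F = "\<lambda>y t. f (\<lambda>k. y (k + t))"
  have F: "?F \<in> path_space \<rightarrow>\<^sub>M path_space"
    by (rule measurable_PiM_single') (auto intro: measurable_compose[OF measurable_shift f])
  have 1: "?F -` S \<in> sets path_space"
    using measurable_sets[OF F S] by (simp add: space_PiM)
  have "?F (\<lambda>t. y (t + 1)) = (\<lambda>t. ?F y (t + 1))" for y
    by (auto simp: algebra_simps)
  then have 2: "(\<lambda>y t. y (t + 1)) -` (?F -` S) = ?F -` S"
    using inv by (auto simp: vimage_def)
  show "prob {\<omega>\<in>space M. (\<lambda>t. Z t \<omega>) \<in> S} \<in> {0, 1}"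
    using invariant_event_trivial[OF 1 2] by (simp add: Z)
qed

text \<open>One function, applied to the consecutive blocks of length \<open>n\<close>, gives again an i.i.d. sequence.\<close>

lemma iid_process_blocks:
  fixes F :: "(int \<Rightarrow> 'b) \<Rightarrow> 'c::topological_space" and n :: nat
  assumes F: "F \<in> borel_measurable path_space" and dep: "depends_on {1..int n} F"
  shows "iid_process M (\<lambda>t \<omega>. F (\<lambda>i. \<eta> (i + int n * t) \<omega>))"
proof
  let ?K = "\<lambda>t. {int n * t + 1..int n * t + int n}"
  let ?H = "\<lambda>t z. F (\<lambda>i. z (i + int n * t))"
  have mH: "?H t \<in> borel_measurable path_space" for t
    by (rule measurable_compose[OF measurable_shift F])
  have "disjoint_family ?K"
    unfolding disjoint_family_on_def
  proof (intro ballI impI)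
    fix t u :: int assume "t \<noteq> u"
    have "int n * t + int n \<le> int n * u" if "t < u" for t u :: int
      using mult_left_mono[of "t + 1" u "int n"] that by (simp add: distrib_left)
    from this[of t u] this[of u t] \<open>t \<noteq> u\<close> show "?K t \<inter> ?K u = {}"
      by (cases t u rule: linorder_cases) auto
  qed
  then have "indep_vars (\<lambda>t. Pi\<^sub>M (?K t) (\<lambda>_. borel)) (\<lambda>t \<omega>. restrict (path \<omega>) (?K t)) UNIV"
    by (intro indep_vars_restrict[OF indep]) auto
  then have "indep_vars (\<lambda>_. borel) (\<lambda>t \<omega>. ?H t (restrict (path \<omega>) (?K t))) UNIV"
    by (rule indep_vars_compose2) (rule measurable_compose[OF measurable_PiM_inclusion mH])
  moreover have "?H t (restrict (path \<omega>) (?K t)) = ?H t (path \<omega>)" for t \<omega>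
    using dep by (auto simp: depends_on_def)
  ultimately show "indep_vars (\<lambda>_. borel) (\<lambda>t \<omega>. F (\<lambda>i. \<eta> (i + int n * t) \<omega>)) UNIV"
    by simp
next
  fix t
  have "distr M borel (\<lambda>\<omega>. F (\<lambda>i. \<eta> (i + h) \<omega>)) = distr (distr M path_space (\<lambda>\<omega> t. \<eta> (t + h) \<omega>)) borel F" for h
    using distr_distr[OF F measurable_path_shift] by (simp add: comp_def)
  from this[of "int n * t"] this[of "int n * 0"]
  show "distr M borel (\<lambda>\<omega>. F (\<lambda>i. \<eta> (i + int n * t) \<omega>)) = distr M borel (\<lambda>\<omega>. F (\<lambda>i. \<eta> (i + int n * 0) \<omega>))"
    by (simp only: path_law_shift)
qed

end

section \<open>Moments of small order\<close>

lemma log_difference_quotient_ge_1: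
  fixes x :: real
  assumes "0 \<le> x"
  shows "1 \<le> x - real (Suc n) * (x powr (1 / real (Suc n)) - 1)"
proof -
  define z where "z = x powr (1 / real (Suc n))"
  have z: "0 \<le> z" by (simp add: z_def)
  have "z ^ Suc n = x"
    using assms by (cases "x = 0") (simp_all add: z_def powr_power del: power_Suc of_nat_Suc)
  moreover have "1 + real (Suc n) * (z - 1) \<le> (1 + (z - 1)) ^ Suc n"
    using z by (intro Bernoulli_inequality) simp
  ultimately show ?thesis by (simp add: z_def)
qed

lemma log_difference_quotient_lim:
  fixes x :: real
  assumes "0 < x"
  shows "(\<lambda>n. real (Suc n) * (x powr (1 / real (Suc n)) - 1)) \<longlonglongrightarrow> ln x"
proof -
  have "((\<lambda>h. x powr h) has_real_derivative ln x) (at 0)"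
    using assms by (auto intro!: derivative_eq_intros)
  then have lim: "((\<lambda>h. (x powr h - 1) / h) \<longlongrightarrow> ln x) (at 0)"
    using assms by (simp add: has_field_derivative_iff)
  have "filterlim (\<lambda>n. 1 / real (Suc n)) (at 0) sequentially"
    unfolding filterlim_at using LIMSEQ_Suc[OF lim_1_over_n] by auto
  from filterlim_compose[OF lim this] show ?thesis
    by (simp add: mult.commute)
qed

lemma measurable_log_ext [measurable]: "log_ext \<in> borel_measurable borel"
  unfolding log_ext_def[abs_def] by measurable

text \<open>
  If \<open>W \<ge> 0\<close> is integrable and \<open>E log W < 0\<close>, possibly \<open>-\<infinity>\<close>, then \<open>E W\<^sup>\<delta> < 1\<close> for some \<open>\<delta> \<in> (0, 1]\<close>.
  Otherwise the difference quotients \<open>n (W\<^sup>1\<^sup>/\<^sup>n - 1)\<close> have expectation at least 0. They converge to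
  \<open>log W\<close> and are less than \<open>W\<close>, so Fatou's lemma for \<open>W - n (W\<^sup>1\<^sup>/\<^sup>n - 1)\<close> gives \<open>E log W \<ge> 0\<close>. The
  hypothesis on the logarithm compares the expectations of its positive and negative parts.
\<close>

lemma (in prob_space) power_mean_less_1:
  fixes W :: "'a \<Rightarrow> real"
  assumes [measurable]: "W \<in> borel_measurable M" and W: "\<And>\<omega>. 0 \<le> W \<omega>"
    and int: "(\<integral>\<^sup>+\<omega>. W \<omega> \<partial>M) < \<infinity>"
    and log: "(\<integral>\<^sup>+\<omega>. e2ennreal (log_ext (W \<omega>)) \<partial>M) < (\<integral>\<^sup>+\<omega>. e2ennreal (- log_ext (W \<omega>)) \<partial>M)"
  obtains \<delta> where "0 < \<delta>" "\<delta> \<le> 1" "(\<integral>\<^sup>+\<omega>. ennreal (W \<omega> powr \<delta>) \<partial>M) < 1"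
proof (rule ccontr)
  assume "\<not> thesis"
  then have ge: "1 \<le> (\<integral>\<^sup>+\<omega>. ennreal (W \<omega> powr (1 / real (Suc n))) \<partial>M)" for n
    using that[of "1 / real (Suc n)"] by (auto simp: not_less[symmetric] simp del: of_nat_Suc)
  define G where "G n \<omega> = W \<omega> - real (Suc n) * (W \<omega> powr (1 / real (Suc n)) - 1)" for n \<omega>
  define P where "P \<omega> = e2ennreal (log_ext (W \<omega>))" for \<omega>
  define N where "N \<omega> = e2ennreal (- log_ext (W \<omega>))" for \<omega>
  have [measurable]: "G n \<in> borel_measurable M" for n
    unfolding G_def[abs_def] by measurable
  have [measurable]: "P \<in> borel_measurable M" "N \<in> borel_measurable M"
    unfolding P_def[abs_def] N_def[abs_def] by measurable
  have G: "1 \<le> G n \<omega>" for n \<omega>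
    unfolding G_def by (rule log_difference_quotient_ge_1[OF W])
  have int_G: "(\<integral>\<^sup>+\<omega>. G n \<omega> \<partial>M) \<le> (\<integral>\<^sup>+\<omega>. W \<omega> \<partial>M)" for n
  proof -
    let ?c = "ennreal (real (Suc n))" and ?w = "\<lambda>\<omega>. W \<omega> powr (1 / real (Suc n))"
    have "ennreal (G n \<omega>) + ?c * ennreal (?w \<omega>) = ennreal (W \<omega>) + ?c" for \<omega>
    proof -
      have "0 \<le> G n \<omega>" using G[of n \<omega>] by simp
      then have "ennreal (G n \<omega>) + ?c * ennreal (?w \<omega>) = ennreal (G n \<omega> + real (Suc n) * ?w \<omega>)"
        by (subst ennreal_plus) (auto simp: ennreal_mult simp del: of_nat_Suc)
      also have "\<dots> = ennreal (W \<omega> + real (Suc n))"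
        by (simp add: G_def algebra_simps)
      finally show ?thesis using W by (simp del: of_nat_Suc)
    qed
    then have "(\<integral>\<^sup>+\<omega>. ennreal (G n \<omega>) + ?c * ennreal (?w \<omega>) \<partial>M) = (\<integral>\<^sup>+\<omega>. ennreal (W \<omega>) + ?c \<partial>M)"
      by simp
    then have eq: "(\<integral>\<^sup>+\<omega>. G n \<omega> \<partial>M) + ?c * (\<integral>\<^sup>+\<omega>. ennreal (?w \<omega>) \<partial>M) = (\<integral>\<^sup>+\<omega>. W \<omega> \<partial>M) + ?c"
      by (simp add: nn_integral_add nn_integral_cmult emeasure_space_1 del: of_nat_Suc)
    have "(\<integral>\<^sup>+\<omega>. G n \<omega> \<partial>M) + ?c * 1 \<le> (\<integral>\<^sup>+\<omega>. W \<omega> \<partial>M) + ?c"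
      unfolding eq[symmetric] by (intro add_left_mono mult_left_mono ge) simp
    then show ?thesis by (simp add: ennreal_add_left_cancel_le add.commute[of _ ?c] del: of_nat_Suc)
  qed
  \<comment> \<open>Adding the positive part avoids the difference \<open>W - log W\<close> in the extended reals.\<close>
  have lim: "(\<lambda>n. ennreal (G n \<omega>) + P \<omega>) \<longlonglongrightarrow> ennreal (W \<omega>) + N \<omega>" for \<omega>
  proof (cases "W \<omega> = 0")
    case True
    then have "G n \<omega> = real (Suc n)" for n by (simp add: G_def)
    moreover have "(\<lambda>n. ennreal (real (Suc n))) \<longlonglongrightarrow> top"
      using of_nat_tendsto_top_ennreal[THEN LIMSEQ_Suc] by (simp add: ennreal_of_nat_eq_real_of_nat)
    ultimately show ?thesis
      using True by (simp add: P_def N_def log_ext_def e2ennreal_neg del: of_nat_Suc)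
  next
    case False
    then have pos: "0 < W \<omega>" using W[of \<omega>] by simp
    have "(\<lambda>n. G n \<omega>) \<longlonglongrightarrow> W \<omega> - ln (W \<omega>)"
      unfolding G_def by (intro tendsto_intros log_difference_quotient_lim pos)
    then have "(\<lambda>n. ennreal (G n \<omega>) + P \<omega>) \<longlonglongrightarrow> ennreal (W \<omega> - ln (W \<omega>)) + P \<omega>"
      by (intro tendsto_intros tendsto_ennrealI)
    moreover have "ln (W \<omega>) \<le> W \<omega>" using pos ln_le_minus_one[of "W \<omega>"] by simp
    then have "ennreal (W \<omega> - ln (W \<omega>)) + P \<omega> = ennreal (W \<omega>) + N \<omega>"
      using pos by (cases "0 \<le> ln (W \<omega>)")
        (simp_all add: P_def N_def log_ext_def ennreal_neg flip: ennreal_plus)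
    ultimately show ?thesis by simp
  qed
  have "(\<integral>\<^sup>+\<omega>. W \<omega> \<partial>M) + (\<integral>\<^sup>+\<omega>. N \<omega> \<partial>M) = (\<integral>\<^sup>+\<omega>. ennreal (W \<omega>) + N \<omega> \<partial>M)"
    by (simp add: nn_integral_add)
  also have "\<dots> = (\<integral>\<^sup>+\<omega>. liminf (\<lambda>n. ennreal (G n \<omega>) + P \<omega>) \<partial>M)"
    by (intro nn_integral_cong lim_imp_Liminf[symmetric] lim) simp
  also have "\<dots> \<le> liminf (\<lambda>n. \<integral>\<^sup>+\<omega>. ennreal (G n \<omega>) + P \<omega> \<partial>M)"
    by (intro nn_integral_liminf) measurable
  also have "\<dots> \<le> (\<integral>\<^sup>+\<omega>. W \<omega> \<partial>M) + (\<integral>\<^sup>+\<omega>. P \<omega> \<partial>M)"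
    using int_G by (intro Liminf_le) (auto simp: nn_integral_add intro!: always_eventually add_right_mono)
  finally have "(\<integral>\<^sup>+\<omega>. N \<omega> \<partial>M) \<le> (\<integral>\<^sup>+\<omega>. P \<omega> \<partial>M)"
    using int by (auto simp: ennreal_add_left_cancel_le)
  with log show False by (simp add: P_def[symmetric] N_def[symmetric])
qed

lemma e2ennreal_cmult:
  assumes "0 < c"
  shows "e2ennreal (ereal c * x) = ennreal c * e2ennreal x"
  using assms by (cases x) (auto simp: ennreal_mult' e2ennreal_neg ennreal_mult_top)

lemma expectation_ext_negD:
  assumes "expectation_ext M X < 0"
  shows "(\<integral>\<^sup>+\<omega>. e2ennreal (X \<omega>) \<partial>M) < (\<integral>\<^sup>+\<omega>. e2ennreal (- X \<omega>) \<partial>M)"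
proof (rule ccontr)
  assume "\<not> ?thesis"
  then have "enn2ereal (\<integral>\<^sup>+\<omega>. e2ennreal (- X \<omega>) \<partial>M) \<le> enn2ereal (\<integral>\<^sup>+\<omega>. e2ennreal (X \<omega>) \<partial>M)"
    by (simp add: not_less less_eq_ennreal.rep_eq)
  with assms show False
    unfolding expectation_ext_def
    by (cases rule: ereal2_cases[of "enn2ereal (\<integral>\<^sup>+\<omega>. e2ennreal (X \<omega>) \<partial>M)"
          "enn2ereal (\<integral>\<^sup>+\<omega>. e2ennreal (- X \<omega>) \<partial>M)"]) auto
qed

lemma powr_le_1_plus:
  fixes x :: real
  assumes "0 \<le> x" "0 \<le> \<delta>" "\<delta> \<le> 1"
  shows "x powr \<delta> \<le> 1 + x"
proof (cases "x \<le> 1")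
  case True
  then have "x powr \<delta> \<le> 1" using assms by (intro powr_le1) auto
  then show ?thesis using assms by simp
next
  case False
  then have "x powr \<delta> \<le> x powr 1" using assms by (intro powr_mono) auto
  then show ?thesis using False by simp
qed

text \<open>
  Moments of an order \<open>\<delta> \<le> 1\<close> suffice, because terms of norm at most 1 are bounded by their power of
  exponent \<open>\<delta>\<close>.
\<close>

lemma AE_summable_of_moments:
  fixes X :: "nat \<Rightarrow> 'a \<Rightarrow> 'c::banach"
  assumes meas: "\<And>k. (\<lambda>\<omega>. norm (X k \<omega>)) \<in> borel_measurable M"
    and \<delta>: "0 < \<delta>" "\<delta> \<le> 1"
    and fin: "(\<Sum>k. \<integral>\<^sup>+\<omega>. ennreal (norm (X k \<omega>) powr \<delta>) \<partial>M) < \<infinity>"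
  shows "AE \<omega> in M. summable (\<lambda>k. norm (X k \<omega>))"
proof -
  note meas [measurable]
  have meas' [measurable]: "(\<lambda>\<omega>. ennreal (norm (X k \<omega>) powr \<delta>)) \<in> borel_measurable M" for k
    by measurable
  have "(\<integral>\<^sup>+\<omega>. (\<Sum>k. ennreal (norm (X k \<omega>) powr \<delta>)) \<partial>M) \<noteq> \<infinity>"
    using fin by (subst nn_integral_suminf) (auto simp: less_top)
  then have "AE \<omega> in M. (\<Sum>k. ennreal (norm (X k \<omega>) powr \<delta>)) \<noteq> \<infinity>"
    by (intro nn_integral_noteq_infinite) measurable
  then show ?thesis
  proof eventually_elim
    case (elim \<omega>)
    let ?x = "\<lambda>k. norm (X k \<omega>)"
    have s: "summable (\<lambda>k. ?x k powr \<delta>)"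
      using elim by (intro summable_suminf_not_top) auto
    then have "eventually (\<lambda>k. ?x k powr \<delta> < 1) sequentially"
      using summable_LIMSEQ_zero[OF s] by (intro order_tendstoD) auto
    then have "eventually (\<lambda>k. norm (?x k) \<le> ?x k powr \<delta>) sequentially"
    proof eventually_elim
      case (elim k)
      have "?x k \<le> 1"
      proof (rule ccontr)
        assume "\<not> ?x k \<le> 1"
        then have "1 \<le> ?x k powr \<delta>" using \<delta> by (intro ge_one_powr_ge_zero) auto
        with elim show False by simp
      qed
      then show ?case
        using powr_mono'[of \<delta> 1 "?x k"] \<delta> by (cases "?x k = 0") auto
    qed
    then show ?case using s by (rule summable_comparison_test_ev)
  qed
qed

section \<open>Operator norms and ordered products of matrices\<close>

text \<open>The operator norm of a matrix, for the Euclidean norms.\<close>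

abbreviation mnorm :: "real^'n^'m \<Rightarrow> real" where
  "mnorm A \<equiv> onorm ((*v) A)"

lemma mnorm_nonneg: "0 \<le> mnorm A"
  by (rule onorm_pos_le[OF matrix_vector_mul_bounded_linear])

lemma norm_matrix_vector_le: "norm (A *v x) \<le> mnorm A * norm x"
  by (rule onorm[OF matrix_vector_mul_bounded_linear])

lemma mnorm_mult_le:
  fixes A :: "real^'n^'m" and B :: "real^'k^'n"
  shows "mnorm (A ** B) \<le> mnorm A * mnorm B"
proof -
  have "(*v) (A ** B) = (*v) A \<circ> (*v) B"
    by (auto simp: matrix_vector_mul_assoc)
  then show ?thesis
    using onorm_compose[OF matrix_vector_mul_bounded_linear[of A] matrix_vector_mul_bounded_linear[of B]]
    by simp
qed

lemma mnorm_mat_1_le: "mnorm (mat 1 :: real^'n^'n) \<le> 1"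
proof -
  have "(*v) (mat 1 :: real^'n^'n) = (\<lambda>x. x)" by auto
  then show ?thesis by (simp only: onorm_id_le)
qed

lemma continuous_on_mnorm: "continuous_on UNIV (mnorm :: real^'n^'m \<Rightarrow> real)"
proof -
  let ?c = "real CARD('m) * real CARD('n)"
  have le: "mnorm A \<le> mnorm B + ?c * norm (A - B)" for A B :: "real^'n^'m"
  proof -
    have "mnorm (B + (A - B)) \<le> mnorm B + mnorm (A - B)"
      unfolding matrix_vector_mult_add_rdistrib
      by (intro onorm_triangle matrix_vector_mul_bounded_linear)
    moreover have "mnorm (A - B) \<le> ?c * norm (A - B)"
      by (rule onorm_le_matrix_component) (metis Finite_Cartesian_Product.norm_nth_le order_trans real_norm_def)
    ultimately show ?thesis by simp
  qed
  have "\<bar>mnorm A - mnorm B\<bar> \<le> ?c * norm (A - B)" for A B :: "real^'n^'m"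
    using le[of A B] le[of B A] by (simp add: norm_minus_commute)
  then have "?c-lipschitz_on UNIV (mnorm :: real^'n^'m \<Rightarrow> real)"
    by (intro lipschitz_onI) (auto simp: dist_norm)
  then show ?thesis by (rule lipschitz_on_continuous_on)
qed

lemma borel_measurable_mnorm [measurable]: "mnorm \<in> borel_measurable borel"
  by (rule borel_measurable_continuous_onI[OF continuous_on_mnorm])

lemma borel_measurable_matrix_mult:
  fixes A :: "'a \<Rightarrow> real^'n^'m" and B :: "'a \<Rightarrow> real^'k^'n"
  assumes "A \<in> borel_measurable N" "B \<in> borel_measurable N"
  shows "(\<lambda>x. A x ** B x) \<in> borel_measurable N"
  by (rule borel_measurable_continuous_Pair[OF assms])
    (auto simp: matrix_matrix_mult_def intro!: continuous_intros)

lemma borel_measurable_matrix_vector_mult: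
  fixes A :: "'a \<Rightarrow> real^'n^'m" and B :: "'a \<Rightarrow> real^'n"
  assumes "A \<in> borel_measurable N" "B \<in> borel_measurable N"
  shows "(\<lambda>x. A x *v B x) \<in> borel_measurable N"
  by (rule borel_measurable_continuous_Pair[OF assms])
    (auto simp: matrix_vector_mult_def intro!: continuous_intros)

lemma mat_prod_empty [simp]: "mat_prod a a F = mat 1"
  by (simp add: mat_prod_def)

lemma mat_prod_Suc:
  assumes "a \<le> b"
  shows "mat_prod a (Suc b) F = mat_prod a b F ** F b"
proof -
  have "foldr (\<lambda>i P. F i ** P) xs A = foldr (\<lambda>i P. F i ** P) xs (mat 1) ** A" for xs A
    by (induction xs) (simp_all add: matrix_mul_assoc)
  from this[of "[a..<b]" "F b"] show ?thesis
    using assms by (simp add: mat_prod_def)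
qed

lemma mat_prod_Suc_Suc: "mat_prod (Suc a) (Suc b) F = mat_prod a b (\<lambda>i. F (Suc i))"
  unfolding mat_prod_def map_Suc_upt[symmetric] foldr_map by (simp add: comp_def)

lemma mat_prod_add: "mat_prod 0 (m + k) F = mat_prod 0 m F ** mat_prod 0 k (\<lambda>i. F (m + i))"
  by (induction k) (simp_all add: mat_prod_Suc matrix_mul_assoc)

lemma mnorm_mat_prod_le: "mnorm (mat_prod 0 k F) \<le> (\<Prod>i<k. mnorm (F i))"
proof (induction k)
  case (Suc k)
  have "mnorm (mat_prod 0 (Suc k) F) \<le> mnorm (mat_prod 0 k F) * mnorm (F k)"
    by (simp add: mat_prod_Suc mnorm_mult_le)
  also have "\<dots> \<le> (\<Prod>i<k. mnorm (F i)) * mnorm (F k)"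
    by (intro mult_right_mono Suc mnorm_nonneg)
  finally show ?case by simp
qed (use mnorm_mat_1_le in \<open>simp only: mat_prod_empty lessThan_0 prod.empty\<close>)

lemma borel_measurable_mat_prod:
  assumes "\<And>i. i < k \<Longrightarrow> F i \<in> borel_measurable N"
  shows "(\<lambda>x. mat_prod 0 k (\<lambda>i. F i x)) \<in> borel_measurable N"
  using assms
  by (induction k) (simp_all add: mat_prod_Suc borel_measurable_matrix_mult)

text \<open>
  \<open>back_prod G k t y = G (y t) ** G (y (t - 1)) ** \<dots> ** G (y (t - k + 1))\<close> for a path \<open>y\<close>.
\<close>

definition back_prod :: "('b \<Rightarrow> real^'n^'n) \<Rightarrow> nat \<Rightarrow> int \<Rightarrow> (int \<Rightarrow> 'b) \<Rightarrow> real^'n^'n" where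
  "back_prod G k t y = mat_prod 0 k (\<lambda>j. G (y (t - int j)))"

lemma back_prod_0 [simp]: "back_prod G 0 t y = mat 1"
  by (simp add: back_prod_def)

lemma back_prod_1 [simp]: "back_prod G (Suc 0) t y = G (y t)"
  by (simp add: back_prod_def mat_prod_Suc)

lemma back_prod_Suc: "back_prod G (Suc k) t y = back_prod G k t y ** G (y (t - int k))"
  by (simp add: back_prod_def mat_prod_Suc)

lemma back_prod_add: "back_prod G (m + k) t y = back_prod G m t y ** back_prod G k (t - int m) y"
  by (simp add: back_prod_def mat_prod_add diff_diff_eq)

lemma back_prod_Suc': "back_prod G (Suc k) t y = G (y t) ** back_prod G k (t - 1) y"
  using back_prod_add[of G 1 k t y] by simp

lemma back_prod_shift: "back_prod G k t (\<lambda>i. y (i + h)) = back_prod G k (t + h) y"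
  by (simp add: back_prod_def algebra_simps)

lemma depends_on_back_prod: "depends_on {t - int k<..t} (back_prod G k t)"
  unfolding depends_on_def
proof (intro allI impI)
  fix y y' :: "int \<Rightarrow> 'a" assume eq: "\<forall>i\<in>{t - int k<..t}. y i = y' i"
  then have "j \<le> k \<Longrightarrow> back_prod G j t y = back_prod G j t y'" for j
    by (induction j) (auto simp: back_prod_Suc)
  then show "back_prod G k t y = back_prod G k t y'" by simp
qed

lemma borel_measurable_back_prod:
  fixes G :: "'b::topological_space \<Rightarrow> real^'n^'n"
  assumes "G \<in> borel_measurable borel"
  shows "back_prod G k t \<in> borel_measurable path_space"
  unfolding back_prod_def[abs_def]
  by (intro borel_measurable_mat_prod measurable_compose[OF _ assms] measurable_component_singleton) simp

section \<open>Moments of products of independent random matrices\<close>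

context iid_process
begin

text \<open>The expectation of the norm, raised to the power \<open>\<delta>\<close>, of a backward product of \<open>k\<close> factors.\<close>

definition moment :: "('b \<Rightarrow> real^'n^'n) \<Rightarrow> real \<Rightarrow> nat \<Rightarrow> ennreal" where
  "moment G \<delta> k = (\<integral>\<^sup>+\<omega>. ennreal (mnorm (back_prod G k 0 (path \<omega>)) powr \<delta>) \<partial>M)"

lemma measurable_mnorm_back_prod:
  assumes "G \<in> borel_measurable borel"
  shows "(\<lambda>y. ennreal (mnorm (back_prod G k t y) powr \<delta>)) \<in> borel_measurable path_space"
  using measurable_compose[OF borel_measurable_back_prod[OF assms] borel_measurable_mnorm]
  by measurable

lemma moment_eq:
  assumes "G \<in> borel_measurable borel"
  shows "(\<integral>\<^sup>+\<omega>. ennreal (mnorm (back_prod G k t (path \<omega>)) powr \<delta>) \<partial>M) = moment G \<delta> k"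
  using nn_integral_shift[OF measurable_mnorm_back_prod[OF assms, of k 0 \<delta>], of t]
    back_prod_shift[of G k 0 "path _" t] by (simp add: moment_def)

text \<open>Disjoint blocks of factors are independent, so the moments are submultiplicative in the length.\<close>

lemma moment_submult:
  assumes G: "G \<in> borel_measurable borel" and \<delta>: "0 \<le> \<delta>"
  shows "moment G \<delta> (m + k) \<le> moment G \<delta> m * moment G \<delta> k"
proof -
  let ?f = "\<lambda>k t y. ennreal (mnorm (back_prod G k t y) powr \<delta>)"
  have "moment G \<delta> (m + k) \<le> (\<integral>\<^sup>+\<omega>. ?f m 0 (path \<omega>) * ?f k (- int m) (path \<omega>) \<partial>M)"
    unfolding moment_def back_prod_add using \<delta>
    by (intro nn_integral_mono)
      (simp add: mnorm_nonneg ennreal_leI powr_mono2 mnorm_mult_le flip: ennreal_mult powr_mult)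
  also have "\<dots> = moment G \<delta> m * moment G \<delta> k"
    unfolding moment_eq[OF G, where t = 0 and k = m, symmetric] moment_eq[OF G, where t = "- int m" and k = k, symmetric]
  proof (rule nn_integral_disjoint)
    show "depends_on {0 - int m<..0} (?f m 0)"
      by (rule depends_on_comp[OF depends_on_back_prod])
    show "depends_on {- int m - int k<..- int m} (?f k (- int m))"
      by (rule depends_on_comp[OF depends_on_back_prod])
  qed (rule measurable_mnorm_back_prod[OF G] | force)+
  finally show ?thesis .
qed

lemma moment_finite:
  fixes G :: "'b \<Rightarrow> real^'n^'n"
  assumes G: "G \<in> borel_measurable borel" and \<delta>: "0 \<le> \<delta>" "\<delta> \<le> 1"
    and int: "(\<integral>\<^sup>+\<omega>. ennreal (mnorm (G (\<eta> 0 \<omega>))) \<partial>M) < \<infinity>"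
  shows "moment G \<delta> k < \<infinity>"
proof (induction k)
  case 0
  have "moment G \<delta> 0 \<le> (\<integral>\<^sup>+\<omega>. 1 \<partial>M)"
    unfolding moment_def back_prod_0
  proof (intro nn_integral_mono)
    have "mnorm (mat 1 :: real^'n^'n) powr \<delta> \<le> 1"
      by (rule powr_le1) (simp_all only: \<delta> abs_of_nonneg mnorm_nonneg mnorm_mat_1_le)
    then show "ennreal (mnorm (mat 1 :: real^'n^'n) powr \<delta>) \<le> 1"
      using ennreal_leI by fastforce
  qed
  then show ?case by (simp add: emeasure_space_1 le_less_trans[OF _ ennreal_one_less_top])
next
  case (Suc k)
  have [measurable]: "(\<lambda>\<omega>. ennreal (mnorm (G (\<eta> 0 \<omega>)))) \<in> borel_measurable M"
    using measurable_compose[OF measurable_compose[OF rv G] borel_measurable_mnorm] by measurable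
  have "moment G \<delta> 1 \<le> (\<integral>\<^sup>+\<omega>. 1 + ennreal (mnorm (G (\<eta> 0 \<omega>))) \<partial>M)"
    unfolding moment_def
  proof (intro nn_integral_mono)
    fix \<omega>
    let ?x = "mnorm (G (\<eta> 0 \<omega>))"
    have "?x powr \<delta> \<le> 1 + ?x"
      by (rule powr_le_1_plus[OF mnorm_nonneg \<delta>])
    then show "ennreal (mnorm (back_prod G 1 0 (path \<omega>)) powr \<delta>) \<le> 1 + ennreal ?x"
      using mnorm_nonneg[of "G (\<eta> 0 \<omega>)"]
      by (simp add: ennreal_leI flip: ennreal_plus ennreal_1)
  qed
  also have "\<dots> < \<infinity>"
    using int by (simp add: nn_integral_add emeasure_space_1)
  finally have "moment G \<delta> k * moment G \<delta> 1 < \<infinity>"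
    using Suc by (simp add: ennreal_mult_less_top)
  then show ?case
    using moment_submult[OF G \<delta>(1), of k 1] by simp
qed

text \<open>
  One moment less than 1 suffices: the partial sums satisfy \<open>S\<^sub>n \<le> R + a\<^sub>N S\<^sub>n\<close>, where \<open>R\<close> is the sum of
  the first \<open>N\<close> moments and \<open>a\<^sub>N < 1\<close>.
\<close>

lemma summable_moments:
  assumes G: "G \<in> borel_measurable borel" and \<delta>: "0 \<le> \<delta>" "\<delta> \<le> 1"
    and int: "(\<integral>\<^sup>+\<omega>. ennreal (mnorm (G (\<eta> 0 \<omega>))) \<partial>M) < \<infinity>"
    and N: "moment G \<delta> N < 1"
  shows "(\<Sum>k. moment G \<delta> k) < \<infinity>"
proof -
  define a where "a k = enn2real (moment G \<delta> k)" for k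
  have a: "moment G \<delta> k = ennreal (a k)" "0 \<le> a k" for k
    using moment_finite[OF G \<delta> int, of k] by (auto simp: a_def less_top)
  have a_add: "a (k + N) \<le> a k * a N" for k
    using moment_submult[OF G \<delta>(1), of k N] by (simp add: a flip: ennreal_mult)
  have aN: "a N < 1" using N by (simp add: a)
  define R where "R = (\<Sum>k<N. a k)"
  have S: "(\<Sum>k<n. a k) \<le> R / (1 - a N)" for n
  proof -
    let ?S = "\<Sum>k<n. a k"
    have "?S \<le> (\<Sum>k<N + n. a k)"
      using a by (intro sum_mono2) auto
    also have "\<dots> = R + (\<Sum>k<n. a (k + N))"
      using sum.nat_group[of a] by (simp add: R_def lessThan_atLeast0 sum.atLeastLessThan_concat[symmetric, of 0 N "N + n"] sum.shift_bounds_nat_ivl[of a 0 N n, simplified, symmetric] add.commute)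
    also have "\<dots> \<le> R + (\<Sum>k<n. a k * a N)"
      by (intro add_left_mono sum_mono a_add)
    also have "\<dots> = R + ?S * a N" by (simp add: sum_distrib_right)
    finally show ?thesis using aN by (simp add: field_simps)
  qed
  have "summable a"
    using a S by (intro summableI_nonneg_bounded) auto
  then show ?thesis
    by (simp add: a suminf_ennreal2)
qed

end

section \<open>Stationary solutions of affine stochastic recursions\<close>

lemma (in prob_space) prob_tendsto_0:
  assumes [measurable]: "\<And>n::nat. E n \<in> events"
    and "AE \<omega> in M. eventually (\<lambda>n. \<omega> \<notin> E n) sequentially"
  shows "(\<lambda>n. prob (E n)) \<longlonglongrightarrow> 0"
proof -
  have "(\<lambda>n. \<integral>\<omega>. indicator (E n) \<omega> \<partial>M) \<longlonglongrightarrow> (\<integral>\<omega>. (0::real) \<partial>M)"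
  proof (rule integral_dominated_convergence[where w = "\<lambda>_. 1"])
    show "AE \<omega> in M. (\<lambda>n. indicator (E n) \<omega> :: real) \<longlonglongrightarrow> 0"
      using assms(2)
    proof eventually_elim
      case (elim \<omega>)
      then show ?case
        by (intro tendsto_eventually) (auto elim!: eventually_mono)
    qed
  qed (auto simp: indicator_def)
  then show ?thesis by simp
qed

lemma strictly_stationary_marginal:
  fixes Z :: "int \<Rightarrow> 'a \<Rightarrow> 'c::topological_space"
  assumes "strictly_stationary M Z" and S: "S \<in> sets borel"
  shows "measure M {\<omega>\<in>space M. Z t \<omega> \<in> S} = measure M {\<omega>\<in>space M. Z 0 \<omega> \<in> S}"
proof -
  have Z: "Z j \<in> borel_measurable M" for j
    using assms(1) unfolding strictly_stationary_def by blast
  have eq: "measure (distr M (Pi\<^sub>M {0} (\<lambda>_. borel)) (\<lambda>\<omega>. \<lambda>j\<in>{0}. Z (j + h) \<omega>)) (Pi\<^sub>E {0} (\<lambda>_. S))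
      = measure M {\<omega>\<in>space M. Z h \<omega> \<in> S}" for h
  proof (subst measure_distr)
    show "(\<lambda>\<omega>. \<lambda>j\<in>{0}. Z (j + h) \<omega>) \<in> M \<rightarrow>\<^sub>M Pi\<^sub>M {0} (\<lambda>_. borel)"
      by (intro measurable_restrict Z)
    show "Pi\<^sub>E {0} (\<lambda>_. S) \<in> sets (Pi\<^sub>M {0::int} (\<lambda>_. borel))"
      using S by (intro sets_PiM_I_finite) auto
  qed (auto intro!: arg_cong[where f = "measure M"])
  have "distr M (Pi\<^sub>M {0} (\<lambda>_. borel)) (\<lambda>\<omega>. \<lambda>j\<in>{0}. Z (j + t) \<omega>)
      = distr M (Pi\<^sub>M {0} (\<lambda>_. borel)) (\<lambda>\<omega>. \<lambda>j\<in>{0}. Z (j + 0) \<omega>)"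
    using assms(1) unfolding strictly_stationary_def add_0_right by blast
  then have "measure M {\<omega>\<in>space M. Z t \<omega> \<in> S}
      = measure (distr M (Pi\<^sub>M {0} (\<lambda>_. borel)) (\<lambda>\<omega>. \<lambda>j\<in>{0}. Z (j + 0) \<omega>)) (Pi\<^sub>E {0} (\<lambda>_. S))"
    by (simp only: eq[of t, symmetric])
  also have "\<dots> = measure M {\<omega>\<in>space M. Z 0 \<omega> \<in> S}"
    by (rule eq)
  finally show ?thesis .
qed

text \<open>
  The recursion \<open>y\<^sub>t = A(\<eta>\<^sub>t) y\<^sub>t\<^sub>-\<^sub>1 + B(\<eta>\<^sub>t)\<close> driven by an i.i.d. sequence, where the matrices \<open>A(x)\<close> factor
  through another space, on which they act as \<open>G(x)\<close>, and the backward products of the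
  \<open>G(\<eta>\<^sub>t)\<close> have summable moments of a small order \<open>\<delta>\<close>.
\<close>

locale affine_recursion = iid_process M \<eta>
  for M :: "'a measure" and \<eta> :: "int \<Rightarrow> 'a \<Rightarrow> 'b::topological_space" +
  fixes A :: "'b \<Rightarrow> real^'m^'m" and B :: "'b \<Rightarrow> real^'m"
    and G :: "'b \<Rightarrow> real^'n^'n" and U :: "real^'n^'m" and L :: "real^'m^'n" and \<delta> :: real
  assumes A: "A \<in> borel_measurable borel" and B: "B \<in> borel_measurable borel"
    and G: "G \<in> borel_measurable borel"
    and A_factor: "\<And>x. A x = A x ** U ** L" and intertwine: "\<And>x. L ** A x = G x ** L"
    and \<delta>: "0 < \<delta>" "\<delta> \<le> 1"
    and int_A: "(\<integral>\<^sup>+\<omega>. ennreal (mnorm (A (\<eta> 0 \<omega>))) \<partial>M) < \<infinity>"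
    and int_B: "(\<integral>\<^sup>+\<omega>. ennreal (norm (B (\<eta> 0 \<omega>))) \<partial>M) < \<infinity>"
    and moments: "(\<Sum>k. moment G \<delta> k) < \<infinity>"
begin

lemma back_prod_factor: "back_prod A (Suc k) t y = A (y t) ** U ** back_prod G k (t - 1) y ** L"
proof -
  have "L ** back_prod A k t y = back_prod G k t y ** L" for k t
  proof (induction k)
    case (Suc k)
    then show ?case
      unfolding back_prod_Suc by (metis intertwine matrix_mul_assoc)
  qed simp
  then show ?thesis
    unfolding back_prod_Suc' by (metis A_factor matrix_mul_assoc)
qed

lemma mnorm_back_prod_le:
  "mnorm (back_prod A (Suc k) t y)
    \<le> (mnorm U * mnorm L) * (mnorm (A (y t)) * mnorm (back_prod G k (t - 1) y))"
proof -
  have "mnorm (back_prod A (Suc k) t y) \<le> mnorm (A (y t) ** U ** back_prod G k (t - 1) y) * mnorm L"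
    unfolding back_prod_factor by (rule mnorm_mult_le)
  also have "\<dots> \<le> (mnorm (A (y t) ** U) * mnorm (back_prod G k (t - 1) y)) * mnorm L"
    by (intro mult_right_mono mnorm_mult_le mnorm_nonneg)
  also have "\<dots> \<le> ((mnorm (A (y t)) * mnorm U) * mnorm (back_prod G k (t - 1) y)) * mnorm L"
    by (intro mult_right_mono mnorm_mult_le mnorm_nonneg)
  finally show ?thesis by (simp add: mult_ac)
qed

text \<open>
  The three factors depend on disjoint sets of innovations, so the moments of order \<open>\<delta>\<close> of the product
  are a constant multiple of those of the middle factor.
\<close>

lemma AE_summable_bound:
  fixes b :: "'b \<Rightarrow> real"
  assumes b: "b \<in> borel_measurable borel" "\<And>x. 0 \<le> b x"
    and int_b: "(\<integral>\<^sup>+\<omega>. ennreal (b (\<eta> 0 \<omega>)) \<partial>M) < \<infinity>"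
  shows "AE \<omega> in M. summable (\<lambda>k. mnorm (A (\<eta> t \<omega>)) * mnorm (back_prod G k (t - 1) (path \<omega>))
    * b (\<eta> (t - int (Suc k)) \<omega>))"
proof -
  let ?a = "\<lambda>x. mnorm (A x)"
  let ?X = "\<lambda>k \<omega>. ?a (\<eta> t \<omega>) * mnorm (back_prod G k (t - 1) (path \<omega>)) * b (\<eta> (t - int (Suc k)) \<omega>)"
  have a: "?a \<in> borel_measurable borel"
    by (rule measurable_compose[OF A borel_measurable_mnorm])
  have nn: "0 \<le> ?X k \<omega>" for k \<omega>
    by (intro mult_nonneg_nonneg mnorm_nonneg b)
  define m where "m c = (\<integral>\<^sup>+\<omega>. ennreal (c (\<eta> 0 \<omega>) powr \<delta>) \<partial>M)" for c
  have cp: "(\<lambda>y. ennreal (c (y i) powr \<delta>)) \<in> borel_measurable path_space"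
    if [measurable]: "c \<in> borel_measurable borel" for c :: "'b \<Rightarrow> real" and i
    by measurable
  have cd: "depends_on {i} (\<lambda>y. ennreal (c (y i) powr \<delta>))" for c :: "'b \<Rightarrow> real" and i
    by (simp add: depends_on_def)
  have m_eq: "(\<integral>\<^sup>+\<omega>. ennreal (c (\<eta> i \<omega>) powr \<delta>) \<partial>M) = m c"
    if "c \<in> borel_measurable borel" for c i
    using nn_integral_shift[OF cp[OF that], of 0 i] by (simp add: m_def)
  have m_fin: "m c < \<infinity>" if [measurable]: "c \<in> borel_measurable borel" and "\<And>x. 0 \<le> c x"
      and "(\<integral>\<^sup>+\<omega>. ennreal (c (\<eta> 0 \<omega>)) \<partial>M) < \<infinity>" for c
  proof -
    have "m c \<le> (\<integral>\<^sup>+\<omega>. 1 + ennreal (c (\<eta> 0 \<omega>)) \<partial>M)"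
      unfolding m_def
    proof (intro nn_integral_mono)
      fix \<omega>
      show "ennreal (c (\<eta> 0 \<omega>) powr \<delta>) \<le> 1 + ennreal (c (\<eta> 0 \<omega>))"
        using powr_le_1_plus[of "c (\<eta> 0 \<omega>)" \<delta>] that(2) \<delta>
        by (simp add: ennreal_leI flip: ennreal_plus ennreal_1)
    qed
    also have "\<dots> < \<infinity>" using that by (simp add: nn_integral_add emeasure_space_1)
    finally show ?thesis .
  qed
  have E: "(\<integral>\<^sup>+\<omega>. ennreal (norm (?X k \<omega>) powr \<delta>) \<partial>M) = m ?a * m b * moment G \<delta> k" for k
  proof -
    let ?f = "\<lambda>y. ennreal (?a (y t) powr \<delta>)"
    let ?g = "\<lambda>y. ennreal (mnorm (back_prod G k (t - 1) y) powr \<delta>)"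
    let ?h = "\<lambda>y. ennreal (b (y (t - int (Suc k))) powr \<delta>)"
    have dg: "depends_on {t - 1 - int k<..t - 1} ?g"
      by (rule depends_on_comp[OF depends_on_back_prod])
    have mg: "?g \<in> borel_measurable path_space" by (rule measurable_mnorm_back_prod[OF G])
    have "(\<integral>\<^sup>+\<omega>. ennreal (norm (?X k \<omega>) powr \<delta>) \<partial>M)
        = (\<integral>\<^sup>+\<omega>. ?f (path \<omega>) * (?g (path \<omega>) * ?h (path \<omega>)) \<partial>M)"
      using b
      by (intro nn_integral_cong)
        (simp add: powr_mult abs_mult mnorm_nonneg abs_of_nonneg ennreal_mult mult.assoc)
    also have "\<dots> = (\<integral>\<^sup>+\<omega>. ?f (path \<omega>) \<partial>M) * (\<integral>\<^sup>+\<omega>. ?g (path \<omega>) * ?h (path \<omega>) \<partial>M)"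
    proof (rule nn_integral_disjoint[OF cp[OF a] _ cd])
      show "(\<lambda>y. ?g y * ?h y) \<in> borel_measurable path_space"
        by (intro borel_measurable_times_ennreal mg cp b)
      show "depends_on {t - int (Suc k)..t - 1} (\<lambda>y. ?g y * ?h y)"
        using dg cd[of "t - int (Suc k)" b] unfolding depends_on_def
        by (intro allI impI arg_cong2[where f = times]) (auto intro!: arg_cong[where f = ennreal])
    qed auto
    also have "(\<integral>\<^sup>+\<omega>. ?g (path \<omega>) * ?h (path \<omega>) \<partial>M)
        = (\<integral>\<^sup>+\<omega>. ?g (path \<omega>) \<partial>M) * (\<integral>\<^sup>+\<omega>. ?h (path \<omega>) \<partial>M)"
      by (rule nn_integral_disjoint[OF mg cp[OF b(1)] dg cd]) auto
    finally show ?thesis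
      by (simp only: m_eq[OF a] m_eq[OF b(1)] moment_eq[OF G] mult_ac)
  qed
  have "(\<Sum>k. \<integral>\<^sup>+\<omega>. ennreal (norm (?X k \<omega>) powr \<delta>) \<partial>M) = m ?a * m b * (\<Sum>k. moment G \<delta> k)"
    unfolding E by (rule ennreal_suminf_cmult)
  also have "\<dots> < \<infinity>"
    using m_fin[OF a mnorm_nonneg int_A] m_fin[OF b int_b] moments
    by (simp add: ennreal_mult_less_top)
  finally have "AE \<omega> in M. summable (\<lambda>k. norm (?X k \<omega>))"
  proof (rule AE_summable_of_moments[OF _ \<delta>, rotated])
    have "(\<lambda>y. mnorm (back_prod G k (t - 1) y)) \<in> borel_measurable path_space" for k
      by (rule measurable_compose[OF borel_measurable_back_prod[OF G] borel_measurable_mnorm])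
    from measurable_compose[OF measurable_path this]
    have [measurable]: "(\<lambda>\<omega>. mnorm (back_prod G k (t - 1) (path \<omega>))) \<in> borel_measurable M" for k .
    note a[measurable] b(1)[measurable]
    show "(\<lambda>\<omega>. norm (?X k \<omega>)) \<in> borel_measurable M" for k by measurable
  qed
  then show ?thesis using nn by simp
qed

lemma AE_summable_series:
  "AE \<omega> in M. summable (\<lambda>k. back_prod A k t (path \<omega>) *v B (\<eta> (t - int k) \<omega>))"
proof -
  have "(\<lambda>x. norm (B x)) \<in> borel_measurable borel" using B by measurable
  from AE_summable_bound[OF this norm_ge_zero int_B, of t] show ?thesis
  proof eventually_elim
    case (elim \<omega>)
    let ?Q = "\<lambda>k. mnorm (A (\<eta> t \<omega>)) * mnorm (back_prod G k (t - 1) (path \<omega>))"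
    have "summable (\<lambda>k. norm (back_prod A (Suc k) t (path \<omega>) *v B (\<eta> (t - int (Suc k)) \<omega>)))"
    proof (rule summable_comparison_test_ev)
      show "summable (\<lambda>k. (mnorm U * mnorm L) * (?Q k * norm (B (\<eta> (t - int (Suc k)) \<omega>))))"
        using elim by (rule summable_mult)
      have "norm (back_prod A (Suc k) t (path \<omega>) *v B (\<eta> (t - int (Suc k)) \<omega>))
          \<le> (mnorm U * mnorm L) * (?Q k * norm (B (\<eta> (t - int (Suc k)) \<omega>)))" for k
      proof -
        have "norm (back_prod A (Suc k) t (path \<omega>) *v B (\<eta> (t - int (Suc k)) \<omega>))
            \<le> mnorm (back_prod A (Suc k) t (path \<omega>)) * norm (B (\<eta> (t - int (Suc k)) \<omega>))"
          by (rule norm_matrix_vector_le)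
        also have "\<dots> \<le> ((mnorm U * mnorm L) * ?Q k) * norm (B (\<eta> (t - int (Suc k)) \<omega>))"
          by (intro mult_right_mono mnorm_back_prod_le norm_ge_zero)
        finally show ?thesis by (simp only: mult.assoc)
      qed
      then show "eventually (\<lambda>k. norm (norm (back_prod A (Suc k) t (path \<omega>) *v B (\<eta> (t - int (Suc k)) \<omega>)))
          \<le> (mnorm U * mnorm L) * (?Q k * norm (B (\<eta> (t - int (Suc k)) \<omega>)))) sequentially"
        by (intro always_eventually allI) (simp only: real_norm_def abs_norm_cancel)
    qed
    then have "summable (\<lambda>k. back_prod A (Suc k) t (path \<omega>) *v B (\<eta> (t - int (Suc k)) \<omega>))"
      by (rule summable_norm_cancel)
    then show ?case by (subst (asm) summable_Suc_iff)
  qed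
qed

lemma AE_mnorm_back_prod_tendsto_0:
  "AE \<omega> in M. (\<lambda>k. mnorm (back_prod A k t (path \<omega>))) \<longlonglongrightarrow> 0"
proof -
  have "AE \<omega> in M. summable (\<lambda>k. mnorm (A (\<eta> t \<omega>)) * mnorm (back_prod G k (t - 1) (path \<omega>)) * 1)"
    by (rule AE_summable_bound[of "\<lambda>_. 1"]) (simp_all add: emeasure_space_1)
  then show ?thesis
  proof eventually_elim
    case (elim \<omega>)
    let ?Q = "\<lambda>k. mnorm (A (\<eta> t \<omega>)) * mnorm (back_prod G k (t - 1) (path \<omega>))"
    have "?Q \<longlonglongrightarrow> 0" using elim by (intro summable_LIMSEQ_zero) simp
    then have "(\<lambda>k. (mnorm U * mnorm L) * ?Q k) \<longlonglongrightarrow> 0" by (rule tendsto_mult_right_zero)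
    then have "(\<lambda>k. mnorm (back_prod A (Suc k) t (path \<omega>))) \<longlonglongrightarrow> 0"
      by (rule tendsto_sandwich[OF _ _ tendsto_const, rotated 2])
        (intro always_eventually allI mnorm_nonneg mnorm_back_prod_le)+
    then show ?case by (rule LIMSEQ_imp_Suc)
  qed
qed

text \<open>
  The difference of two solutions at time \<open>t\<close> is a backward product applied to their difference at
  time \<open>t - k\<close>. The product tends to 0, and by stationarity the difference is bounded in probability
  uniformly in \<open>k\<close>.
\<close>

lemma AE_solution_unique:
  fixes Y Z :: "int \<Rightarrow> 'a \<Rightarrow> real^'m"
  assumes "strictly_stationary M Y" "strictly_stationary M Z"
    and Y: "\<And>t. AE \<omega> in M. Y t \<omega> = A (\<eta> t \<omega>) *v Y (t - 1) \<omega> + B (\<eta> t \<omega>)"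
    and Z: "\<And>t. AE \<omega> in M. Z t \<omega> = A (\<eta> t \<omega>) *v Z (t - 1) \<omega> + B (\<eta> t \<omega>)"
  shows "AE \<omega> in M. Z t \<omega> = Y t \<omega>"
proof -
  have [measurable]: "Y j \<in> borel_measurable M" "Z j \<in> borel_measurable M" for j
    using assms(1,2) unfolding strictly_stationary_def by blast+
  have P [measurable]: "(\<lambda>\<omega>. mnorm (back_prod A k t (path \<omega>))) \<in> borel_measurable M" for k
    by (rule measurable_compose[OF measurable_path
          measurable_compose[OF borel_measurable_back_prod[OF A] borel_measurable_mnorm]])
  define D where "D j \<omega> = Z j \<omega> - Y j \<omega>" for j \<omega>
  have "AE \<omega> in M. \<forall>j. D j \<omega> = A (\<eta> j \<omega>) *v D (j - 1) \<omega>"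
    unfolding AE_all_countable
  proof
    fix j show "AE \<omega> in M. D j \<omega> = A (\<eta> j \<omega>) *v D (j - 1) \<omega>"
      using Y[of j] Z[of j]
      by eventually_elim (simp add: D_def matrix_vector_mult_diff_distrib)
  qed
  then have D: "AE \<omega> in M. \<forall>k. D t \<omega> = back_prod A k t (path \<omega>) *v D (t - int k) \<omega>"
  proof eventually_elim
    case (elim \<omega>)
    show ?case
    proof
      fix k show "D t \<omega> = back_prod A k t (path \<omega>) *v D (t - int k) \<omega>"
      proof (induction k)
        case (Suc k)
        have "D (t - int k) \<omega> = A (\<eta> (t - int k) \<omega>) *v D (t - int k - 1) \<omega>"
          using elim by blast
        with Suc show ?case
          by (simp add: back_prod_Suc matrix_vector_mul_assoc diff_diff_eq add.commute)
      qed simp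
    qed
  qed
  have small: "prob {\<omega>\<in>space M. e < norm (D t \<omega>)} \<le> 0" if e: "0 < e" for e
  proof -
    let ?p = "prob {\<omega>\<in>space M. e < norm (D t \<omega>)}"
    define tail where "tail X K = prob {\<omega>\<in>space M. real K < norm (X \<omega>)}" for X :: "'a \<Rightarrow> real^'m" and K
    have tail_0: "tail X \<longlonglongrightarrow> 0" if [measurable]: "X \<in> borel_measurable M" for X
      unfolding tail_def[abs_def]
    proof (rule prob_tendsto_0)
      show "AE \<omega> in M. eventually (\<lambda>K. \<omega> \<notin> {\<omega>\<in>space M. real K < norm (X \<omega>)}) sequentially"
      proof (rule AE_I2)
        fix \<omega>
        obtain K where "norm (X \<omega>) \<le> real K" using real_arch_simple by blast
        then show "eventually (\<lambda>K. \<omega> \<notin> {\<omega>\<in>space M. real K < norm (X \<omega>)}) sequentially"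
          by (intro eventually_sequentiallyI[of K]) auto
      qed
    qed measurable
    have tail_stat: "tail (X j) K = tail (X 0) K" if "strictly_stationary M X" for X j K
      using strictly_stationary_marginal[OF that, of "{x. real K < norm x}" j]
      by (simp add: tail_def)
    have le: "?p \<le> tail (Z 0) K + tail (Y 0) K" for K
    proof -
      define q where "q k = prob {\<omega>\<in>space M. e < mnorm (back_prod A k t (path \<omega>)) * (2 * real K)}" for k
      have "q \<longlonglongrightarrow> 0"
        unfolding q_def[abs_def]
      proof (rule prob_tendsto_0)
        show "AE \<omega> in M. eventually (\<lambda>k. \<omega> \<notin> {\<omega>\<in>space M. e < mnorm (back_prod A k t (path \<omega>)) * (2 * real K)}) sequentially"
          using AE_mnorm_back_prod_tendsto_0[of t]
        proof eventually_elim
          case (elim \<omega>)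
          then have "(\<lambda>k. mnorm (back_prod A k t (path \<omega>)) * (2 * real K)) \<longlonglongrightarrow> 0"
            by (rule tendsto_mult_left_zero)
          then have "eventually (\<lambda>k. mnorm (back_prod A k t (path \<omega>)) * (2 * real K) < e) sequentially"
            using e by (rule order_tendstoD)
          then show ?case by eventually_elim auto
        qed
      qed measurable
      moreover have "?p \<le> q k + (tail (Z 0) K + tail (Y 0) K)" for k
      proof -
        let ?E1 = "{\<omega>\<in>space M. e < mnorm (back_prod A k t (path \<omega>)) * (2 * real K)}"
        let ?E2 = "{\<omega>\<in>space M. real K < norm (Z (t - int k) \<omega>)}"
        let ?E3 = "{\<omega>\<in>space M. real K < norm (Y (t - int k) \<omega>)}"
        have "?p \<le> prob (?E1 \<union> (?E2 \<union> ?E3))"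
        proof (rule finite_measure_mono_AE)
          show "AE \<omega> in M. \<omega> \<in> {\<omega>\<in>space M. e < norm (D t \<omega>)} \<longrightarrow> \<omega> \<in> ?E1 \<union> (?E2 \<union> ?E3)"
            using D
          proof eventually_elim
            case (elim \<omega>)
            show ?case
            proof (rule ccontr)
              assume neg: "\<not> ?case"
              have "norm (D (t - int k) \<omega>) \<le> norm (Z (t - int k) \<omega>) + norm (Y (t - int k) \<omega>)"
                unfolding D_def by (rule norm_triangle_ineq4)
              also have "\<dots> \<le> 2 * real K" using neg by auto
              finally have "mnorm (back_prod A k t (path \<omega>)) * norm (D (t - int k) \<omega>)
                  \<le> mnorm (back_prod A k t (path \<omega>)) * (2 * real K)"
                by (intro mult_left_mono mnorm_nonneg)
              moreover have "norm (D t \<omega>) \<le> mnorm (back_prod A k t (path \<omega>)) * norm (D (t - int k) \<omega>)"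
                using elim norm_matrix_vector_le by metis
              ultimately show False using neg by auto
            qed
          qed
        qed measurable
        also have "\<dots> \<le> prob ?E1 + prob (?E2 \<union> ?E3)"
          by (rule measure_Un_le) measurable
        also have "prob (?E2 \<union> ?E3) \<le> prob ?E2 + prob ?E3"
          by (rule measure_Un_le) measurable
        finally show ?thesis
          using tail_stat[OF assms(2), of "t - int k" K] tail_stat[OF assms(1), of "t - int k" K]
          by (simp add: q_def tail_def)
      qed
      ultimately have "?p \<le> 0 + (tail (Z 0) K + tail (Y 0) K)"
        by (intro LIMSEQ_le_const[OF tendsto_add[OF _ tendsto_const]]) auto
      then show ?thesis by simp
    qed
    have "(\<lambda>K. tail (Z 0) K + tail (Y 0) K) \<longlonglongrightarrow> 0 + 0"
      by (intro tendsto_add tail_0) measurable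
    then show ?thesis
      using le by (intro LIMSEQ_le_const) auto
  qed
  have "AE \<omega> in M. \<forall>n. \<not> 1 / real (Suc n) < norm (D t \<omega>)"
    unfolding AE_all_countable
  proof
    fix n
    have [measurable]: "D t \<in> borel_measurable M" unfolding D_def[abs_def] by measurable
    have "prob {\<omega>\<in>space M. 1 / real (Suc n) < norm (D t \<omega>)} = 0"
      using small[of "1 / real (Suc n)"] by (intro antisym) auto
    then show "AE \<omega> in M. \<not> 1 / real (Suc n) < norm (D t \<omega>)"
      by (subst (asm) prob_eq_0) (auto elim: AE_mp)
  qed
  then show ?thesis
  proof eventually_elim
    case (elim \<omega>)
    have "norm (D t \<omega>) \<le> 0"
    proof (rule LIMSEQ_le_const)
      show "(\<lambda>n. 1 / real (Suc n)) \<longlonglongrightarrow> 0" by (rule LIMSEQ_Suc[OF lim_1_over_n])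
    qed (use elim in \<open>auto simp: not_less\<close>)
    then show ?case by (simp add: D_def)
  qed
qed

context
  fixes Y :: "int \<Rightarrow> 'a \<Rightarrow> real^'m"
  assumes Y: "\<And>t \<omega>. Y t \<omega> =
    (\<Sum>k. back_prod A (Suc k) t (path \<omega>) *v B (\<eta> (t - int (Suc k)) \<omega>)) + B (\<eta> t \<omega>)"
begin

lemma AE_series_solves: "AE \<omega> in M. Y t \<omega> = A (\<eta> t \<omega>) *v Y (t - 1) \<omega> + B (\<eta> t \<omega>)"
  using AE_summable_series[of "t - 1"]
proof eventually_elim
  case (elim \<omega>)
  let ?u = "\<lambda>k. back_prod A k (t - 1) (path \<omega>) *v B (\<eta> (t - 1 - int k) \<omega>)"
  have "Y (t - 1) \<omega> = (\<Sum>k. ?u k)"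
    using suminf_split_head[OF elim] by (simp add: Y)
  then have "A (\<eta> t \<omega>) *v Y (t - 1) \<omega> = (\<Sum>k. A (\<eta> t \<omega>) *v ?u k)"
    using bounded_linear.suminf[OF matrix_vector_mul_bounded_linear elim] by simp
  also have "\<dots> = (\<Sum>k. back_prod A (Suc k) t (path \<omega>) *v B (\<eta> (t - int (Suc k)) \<omega>))"
    by (simp add: back_prod_Suc' matrix_vector_mul_assoc diff_diff_eq)
  finally show ?case by (simp add: Y)
qed

lemma causal_functional:
  "\<exists>f \<in> borel_measurable (Pi\<^sub>M (UNIV :: nat set) (\<lambda>_. borel)). \<forall>t \<omega>. Y t \<omega> = f (\<lambda>k. \<eta> (t - int k) \<omega>)"
proof (intro bexI allI)
  let ?f = "\<lambda>u. (\<Sum>k. mat_prod 0 (Suc k) (\<lambda>j. A (u j)) *v B (u (Suc k))) + B (u 0)"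
  show "?f \<in> borel_measurable (Pi\<^sub>M (UNIV :: nat set) (\<lambda>_. borel))"
    by (intro borel_measurable_add borel_measurable_suminf borel_measurable_matrix_vector_mult
        borel_measurable_mat_prod measurable_compose[OF _ A] measurable_compose[OF _ B]
        measurable_component_singleton) auto
  show "Y t \<omega> = ?f (\<lambda>k. \<eta> (t - int k) \<omega>)" for t \<omega>
    by (simp add: Y back_prod_def)
qed

lemma causal_series: "causal M \<eta> Y"
  using causal_functional unfolding causal_def by blast

lemma stationary_ergodic_series: "strictly_stationary M Y" "ergodic_process M Y"
proof -
  obtain f where f: "f \<in> borel_measurable (Pi\<^sub>M (UNIV :: nat set) (\<lambda>_. borel))"
    and Yf: "\<And>t \<omega>. Y t \<omega> = f (\<lambda>k. \<eta> (t - int k) \<omega>)"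
    using causal_functional by blast
  have "(\<lambda>y k. y (- int k)) \<in> path_space \<rightarrow>\<^sub>M Pi\<^sub>M (UNIV :: nat set) (\<lambda>_. borel :: 'b measure)"
    by (rule measurable_PiM_single') auto
  from measurable_compose[OF this f] have "(\<lambda>y. f (\<lambda>k. y (- int k))) \<in> borel_measurable path_space" .
  moreover have "Y t \<omega> = f (\<lambda>k. \<eta> (- int k + t) \<omega>)" for t \<omega>
    by (simp add: Yf)
  ultimately show "strictly_stationary M Y" "ergodic_process M Y"
    by (auto intro: strictly_stationary_factor ergodic_factor)
qed

end
end

section \<open>The matrices of the periodic GARCH model\<close>

lemma borel_measurable_vecI:
  fixes f :: "'a \<Rightarrow> 'c::euclidean_space^'n"
  assumes "\<And>i. (\<lambda>x. f x $ i) \<in> borel_measurable N"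
  shows "f \<in> borel_measurable N"
proof (subst borel_measurable_euclidean_space, intro ballI)
  fix e :: "'c^'n" assume "e \<in> Basis"
  then obtain i b where "e = axis i b" by (auto simp: Basis_vec_def)
  then show "(\<lambda>x. f x \<bullet> e) \<in> borel_measurable N"
    using assms[of i] by (simp add: inner_axis borel_measurable_inner)
qed

lemma borel_measurable_vec_nth:
  fixes f :: "'a \<Rightarrow> 'c::euclidean_space^'n"
  assumes "f \<in> borel_measurable N"
  shows "(\<lambda>x. f x $ i) \<in> borel_measurable N"
  by (rule measurable_compose[OF assms borel_measurable_continuous_onI])
    (intro continuous_intros)

lemma borel_measurable_phi:
  "(phi \<alpha> \<beta> v :: real^'s::{finite,linorder} \<Rightarrow>
      real^('p::{finite,linorder} + 'q::{finite,linorder})^('p + 'q)) \<in> borel_measurable borel"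
proof (intro borel_measurable_vecI)
  fix r c :: "'p + 'q"
  have [measurable]: "(\<lambda>x :: real^'s::_. x $ elt v) \<in> borel_measurable borel"
    by (rule borel_measurable_vec_nth) simp
  show "(\<lambda>x :: real^'s::_. phi \<alpha> \<beta> v x $ r $ c) \<in> borel_measurable borel"
    unfolding phi_def block_matrix_def by (cases r; cases c) simp_all
qed

lemma borel_measurable_b_vec:
  "(b_vec \<alpha>0 v :: real^'s::{finite,linorder} \<Rightarrow>
      real^('p::{finite,linorder} + 'q::{finite,linorder})) \<in> borel_measurable borel"
proof (intro borel_measurable_vecI)
  fix r :: "'p + 'q"
  have [measurable]: "(\<lambda>x :: real^'s::_. x $ elt v) \<in> borel_measurable borel"
    by (rule borel_measurable_vec_nth) simp
  show "(\<lambda>x :: real^'s::_. b_vec \<alpha>0 v x $ r) \<in> borel_measurable borel"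
    unfolding b_vec_def by (cases r) simp_all
qed

lemma borel_measurable_Phi:
  "(Phi \<alpha> \<beta> :: real^'s::{finite,linorder} \<Rightarrow>
      real^('p::{finite,linorder} + 'q::{finite,linorder})^('p + 'q)) \<in> borel_measurable borel"
  unfolding Phi_def[abs_def] by (intro borel_measurable_mat_prod borel_measurable_phi)

lemma borel_measurable_A_mat:
  "(A_mat \<alpha> \<beta> :: real^'s::{finite,linorder} \<Rightarrow>
      real^('s \<times> ('p::{finite,linorder} + 'q::{finite,linorder}))^('s \<times> ('p + 'q))) \<in> borel_measurable borel"
proof (intro borel_measurable_vecI)
  fix r c :: "'s \<times> ('p + 'q)"
  have "(\<lambda>x. mat_prod 0 (position (fst r)) (\<lambda>i. phi \<alpha> \<beta> (position (fst r) - i) x) $ snd r $ snd c)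
      \<in> borel_measurable (borel :: (real^'s::_) measure)"
    by (intro borel_measurable_vec_nth borel_measurable_mat_prod borel_measurable_phi)
  then show "(\<lambda>x :: real^'s::_. A_mat \<alpha> \<beta> x $ r $ c) \<in> borel_measurable borel"
    by (cases "position (fst c) = CARD('s)") (simp_all add: A_mat_def Let_def)
qed

lemma borel_measurable_B_vec:
  "(B_vec \<alpha>0 \<alpha> \<beta> :: real^'s::{finite,linorder} \<Rightarrow>
      real^('s \<times> ('p::{finite,linorder} + 'q::{finite,linorder}))) \<in> borel_measurable borel"
proof (intro borel_measurable_vecI)
  fix r :: "'s \<times> ('p + 'q)"
  have "(\<lambda>x. (\<Sum>k = 1..position (fst r). mat_prod 0 (position (fst r) - k)
        (\<lambda>i. phi \<alpha> \<beta> (position (fst r) - i) x) *v b_vec \<alpha>0 k x) $ snd r)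
      \<in> borel_measurable (borel :: (real^'s::_) measure)"
    by (intro borel_measurable_vec_nth borel_measurable_sum borel_measurable_matrix_vector_mult
        borel_measurable_mat_prod borel_measurable_phi borel_measurable_b_vec)
  then show "(\<lambda>x :: real^'s::_. B_vec \<alpha>0 \<alpha> \<beta> x $ r) \<in> borel_measurable borel"
    by (simp add: B_vec_def Let_def)
qed

text \<open>The projection to the last block, and the inclusion of the last block.\<close>

definition last_proj :: "real^('s::{finite,linorder} \<times> 'd::finite)^'d" where
  "last_proj = (\<chi> a c. if c = (elt CARD('s), a) then 1 else 0)"

definition last_incl :: "real^'d::finite^('s::{finite,linorder} \<times> 'd)" where
  "last_incl = (\<chi> c a. if c = (elt CARD('s), a) then 1 else 0)"

lemma position_in_range: "position (i :: 'n::{finite,linorder}) \<in> {1..CARD('n)}"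
  using bij_betw_position[where 'n = 'n] by (auto simp: bij_betw_def)

lemma position_eq_card_iff:
  fixes i :: "'s::{finite,linorder}"
  shows "position i = CARD('s) \<longleftrightarrow> i = elt CARD('s)"
proof -
  have "CARD('s) \<in> {1..CARD('s)}" by (simp add: Suc_leI)
  from position_elt[OF this] show ?thesis by (metis elt_position)
qed

lemma matrix_mult_last_proj:
  fixes X :: "real^'d::finite^'m"
  shows "(X ** (last_proj :: real^('s::{finite,linorder} \<times> 'd)^'d)) $ r $ c
    = (if fst c = elt CARD('s) then X $ r $ snd c else 0)"
proof -
  have "X $ r $ a * (if c = (elt CARD('s), a) then 1 else 0)
      = (if a = snd c then if fst c = elt CARD('s) then X $ r $ a else 0 else 0)" for a
    by (cases c) auto
  then show ?thesis
    by (simp add: matrix_matrix_mult_def last_proj_def)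
qed

lemma matrix_mult_last_incl:
  fixes X :: "real^('s::{finite,linorder} \<times> 'd::finite)^'m"
  shows "(X ** last_incl) $ r $ a = X $ r $ (elt CARD('s), a)"
proof -
  have "X $ r $ c * (if c = (elt CARD('s), a) then 1 else 0)
      = (if c = (elt CARD('s), a) then X $ r $ c else 0)" for c
    by simp
  then show ?thesis
    by (simp add: matrix_matrix_mult_def last_incl_def)
qed

lemma last_proj_matrix_mult:
  fixes X :: "real^'m^('s::{finite,linorder} \<times> 'd::finite)"
  shows "(last_proj ** X) $ a $ c = X $ (elt CARD('s), a) $ c"
proof -
  have "(if r = (elt CARD('s), a) then 1 else 0) * X $ r $ c
      = (if r = (elt CARD('s), a) then X $ r $ c else 0)" for r
    by simp
  then show ?thesis
    by (simp add: matrix_matrix_mult_def last_proj_def)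
qed

text \<open>
  Only the last block column of \<open>A_mat\<close> is nonzero, and its last block is \<open>Phi\<close>. Hence products of
  the matrices \<open>A_mat\<close> reduce to products of the matrices \<open>Phi\<close>.
\<close>

lemma A_mat_factor:
  fixes x :: "real^'s::{finite,linorder}"
  shows "(A_mat \<alpha> \<beta> x :: real^('s \<times> ('p::{finite,linorder} + 'q::{finite,linorder}))^('s \<times> ('p + 'q)))
    = A_mat \<alpha> \<beta> x ** last_incl ** last_proj"
  unfolding vec_eq_iff matrix_mult_last_proj matrix_mult_last_incl
  by (auto simp: A_mat_def Let_def position_eq_card_iff)

lemma last_proj_A_mat:
  fixes x :: "real^'s::{finite,linorder}"
  shows "last_proj ** (A_mat \<alpha> \<beta> x :: real^('s \<times> ('p::{finite,linorder} + 'q::{finite,linorder}))^('s \<times> ('p + 'q)))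
    = Phi \<alpha> \<beta> x ** last_proj"
proof -
  have last: "position (elt CARD('s) :: 's) = CARD('s)"
    by (simp add: position_eq_card_iff)
  show ?thesis
    unfolding vec_eq_iff matrix_mult_last_proj last_proj_matrix_mult
    by (simp add: A_mat_def Phi_def Let_def position_eq_card_iff last)
qed

text \<open>
  In each season the coefficients are affine in the squared innovation of that season, hence the norms
  of all matrices and vectors are bounded by the product of affine functions of the squared innovations
  of the period.
\<close>

lemma seasonal_bound:
  obtains c :: real where "1 \<le> c"
    and "\<And>v x. v \<in> {1..CARD('s)} \<Longrightarrow> (\<And>i. 0 \<le> x $ i) \<Longrightarrow>
      mnorm (phi \<alpha> \<beta> v (x :: real^'s::{finite,linorder}) ::
        real^('p::{finite,linorder} + 'q::{finite,linorder})^('p + 'q)) \<le> c * (1 + x $ elt v)"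
    and "\<And>v x. v \<in> {1..CARD('s)} \<Longrightarrow> (\<And>i. 0 \<le> x $ i) \<Longrightarrow>
      norm (b_vec \<alpha>0 v (x :: real^'s::_) :: real^('p + 'q)) \<le> c * (1 + x $ elt v)"
proof -
  define K where "K = 1 + (\<Sum>v = 1..CARD('s). \<bar>\<alpha>0 v\<bar> + (\<Sum>k = 1..CARD('p). \<bar>\<alpha> k v\<bar>) + (\<Sum>k = 1..CARD('q). \<bar>\<beta> k v\<bar>))"
  have K1: "1 \<le> K" unfolding K_def by (auto intro!: sum_nonneg add_nonneg_nonneg)
  have KS: "\<bar>\<alpha>0 v\<bar> + (\<Sum>k = 1..CARD('p). \<bar>\<alpha> k v\<bar>) + (\<Sum>k = 1..CARD('q). \<bar>\<beta> k v\<bar>) \<le> K"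
    if "v \<in> {1..CARD('s)}" for v
    using that member_le_sum[of v "{1..CARD('s)}"
      "\<lambda>v. \<bar>\<alpha>0 v\<bar> + (\<Sum>k = 1..CARD('p). \<bar>\<alpha> k v\<bar>) + (\<Sum>k = 1..CARD('q). \<bar>\<beta> k v\<bar>)"]
    by (simp add: K_def sum_nonneg)
  have nn: "0 \<le> (\<Sum>k = 1..CARD('p). \<bar>\<alpha> k v\<bar>)" "0 \<le> (\<Sum>k = 1..CARD('q). \<bar>\<beta> k v\<bar>)" for v
    by (intro sum_nonneg; simp)+
  have Ka: "\<bar>\<alpha> (position (k :: 'p)) v\<bar> \<le> K" if "v \<in> {1..CARD('s)}" for k v
  proof -
    have "\<bar>\<alpha> (position k) v\<bar> \<le> (\<Sum>k = 1..CARD('p). \<bar>\<alpha> k v\<bar>)"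
      by (rule member_le_sum[OF position_in_range, where f = "\<lambda>k. \<bar>\<alpha> k v\<bar>"]) auto
    with KS[OF that] nn[of v] show ?thesis by linarith
  qed
  have Kb: "\<bar>\<beta> (position (k :: 'q)) v\<bar> \<le> K" if "v \<in> {1..CARD('s)}" for k v
  proof -
    have "\<bar>\<beta> (position k) v\<bar> \<le> (\<Sum>k = 1..CARD('q). \<bar>\<beta> k v\<bar>)"
      by (rule member_le_sum[OF position_in_range, where f = "\<lambda>k. \<bar>\<beta> k v\<bar>"]) auto
    with KS[OF that] nn[of v] show ?thesis by linarith
  qed
  have K0: "\<bar>\<alpha>0 v\<bar> \<le> K" if "v \<in> {1..CARD('s)}" for v
    using KS[OF that] nn[of v] by linarith
  have le: "\<bar>a * y\<bar> \<le> K * (1 + y)" "\<bar>a\<bar> \<le> K * (1 + y)" if "\<bar>a\<bar> \<le> K" "0 \<le> y" for a y :: real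
  proof -
    have "\<bar>a * y\<bar> \<le> K * y" using that by (simp add: abs_mult mult_right_mono)
    then show "\<bar>a * y\<bar> \<le> K * (1 + y)" using K1 by (simp add: algebra_simps)
    have "0 \<le> K * y" using K1 that by simp
    then show "\<bar>a\<bar> \<le> K * (1 + y)" unfolding distrib_left using that by linarith
  qed
  have le1: "1 \<le> K * (1 + y)" "0 \<le> K * (1 + y)" if "0 \<le> y" for y :: real
    using le(2)[of 1 y] that K1 by auto
  let ?d = "real CARD('p + 'q)"
  have d1: "1 \<le> ?d" by (simp add: Suc_leI del: card_sum)
  show ?thesis
  proof (rule that[of "?d * ?d * K"])
    have "1 * 1 * 1 \<le> ?d * ?d * K"
      using d1 K1 by (intro mult_mono) auto
    then show "1 \<le> ?d * ?d * K" by simp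
  next
    fix v and x :: "real^'s::_" assume v: "v \<in> {1..CARD('s)}" and x: "\<And>i. 0 \<le> x $ i"
    have "\<bar>phi \<alpha> \<beta> v x $ r $ c\<bar> \<le> K * (1 + x $ elt v)" for r c :: "'p + 'q"
      unfolding phi_def block_matrix_def
      using le[OF Ka[OF v] x[of "elt v"]] le[OF Kb[OF v] x[of "elt v"]] le1[OF x[of "elt v"]]
      by (cases r; cases c) auto
    then show "mnorm (phi \<alpha> \<beta> v x :: real^('p + 'q)^('p + 'q)) \<le> ?d * ?d * K * (1 + x $ elt v)"
      using onorm_le_matrix_component[of "phi \<alpha> \<beta> v x :: real^('p + 'q)^('p + 'q)" "K * (1 + x $ elt v)"]
      by (simp only: mult.assoc)
  next
    fix v and x :: "real^'s::_" assume v: "v \<in> {1..CARD('s)}" and x: "\<And>i. 0 \<le> x $ i"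
    have "\<bar>b_vec \<alpha>0 v x $ r\<bar> \<le> K * (1 + x $ elt v)" for r :: "'p + 'q"
      unfolding b_vec_def
      using le[OF K0[OF v] x[of "elt v"]] le1[OF x[of "elt v"]]
      by (cases r) auto
    then have "(\<Sum>r\<in>UNIV. \<bar>(b_vec \<alpha>0 v x :: real^('p + 'q)) $ r\<bar>) \<le> ?d * (K * (1 + x $ elt v))"
      by (intro sum_bounded_above) 
    then have "norm (b_vec \<alpha>0 v x :: real^('p + 'q)) \<le> ?d * (K * (1 + x $ elt v))"
      using norm_le_l1_cart order_trans by blast
    also have "\<dots> \<le> ?d * (?d * (K * (1 + x $ elt v)))"
      using d1 le1[OF x[of "elt v"]] by (intro mult_left_mono) (auto simp: mult_le_cancel_right1)
    finally show "norm (b_vec \<alpha>0 v x :: real^('p + 'q)) \<le> ?d * ?d * K * (1 + x $ elt v)"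
      by (simp only: mult.assoc)
  qed
qed

lemma period_bound:
  obtains c C :: real where "1 \<le> c" "0 \<le> C"
    and "\<And>x. (\<And>i. 0 \<le> x $ i) \<Longrightarrow> mnorm (Phi \<alpha> \<beta> (x :: real^'s::{finite,linorder}) ::
        real^('p::{finite,linorder} + 'q::{finite,linorder})^('p + 'q))
      \<le> C * (\<Prod>v = 1..CARD('s). c * (1 + x $ elt v))"
    and "\<And>x. (\<And>i. 0 \<le> x $ i) \<Longrightarrow> mnorm (A_mat \<alpha> \<beta> (x :: real^'s::_) ::
        real^('s \<times> ('p + 'q))^('s \<times> ('p + 'q)))
      \<le> C * (\<Prod>v = 1..CARD('s). c * (1 + x $ elt v))"
    and "\<And>x. (\<And>i. 0 \<le> x $ i) \<Longrightarrow> norm (B_vec \<alpha>0 \<alpha> \<beta> (x :: real^'s::_) :: real^('s \<times> ('p + 'q)))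
      \<le> C * (\<Prod>v = 1..CARD('s). c * (1 + x $ elt v))"
proof -
  obtain c where c: "1 \<le> c"
    and phi_le: "\<And>v x. v \<in> {1..CARD('s)} \<Longrightarrow> (\<And>i. 0 \<le> x $ i) \<Longrightarrow>
      mnorm (phi \<alpha> \<beta> v (x :: real^'s::_) :: real^('p + 'q)^('p + 'q)) \<le> c * (1 + x $ elt v)"
    and b_le: "\<And>v x. v \<in> {1..CARD('s)} \<Longrightarrow> (\<And>i. 0 \<le> x $ i) \<Longrightarrow>
      norm (b_vec \<alpha>0 v (x :: real^'s::_) :: real^('p + 'q)) \<le> c * (1 + x $ elt v)"
    using seasonal_bound by blast
  define f where "f x v = c * (1 + x $ elt v)" for x :: "real^'s::_" and v
  define W where "W x = (\<Prod>v = 1..CARD('s). f x v)" for x :: "real^'s::_"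
  have f1: "1 \<le> f x v" if "\<And>i. 0 \<le> x $ i" for x v
    using mult_mono[of 1 c 1 "1 + x $ elt v"] c that by (simp add: f_def)
  have sub: "prod (f x) S \<le> W x" if "\<And>i. 0 \<le> x $ i" "S \<subseteq> {1..CARD('s)}" for x S
    unfolding W_def using f1[OF that(1)] that(2)
    by (intro prod_mono2) (auto intro: order_trans[OF zero_le_one])
  have prod_le: "mnorm (mat_prod 0 n (\<lambda>i. phi \<alpha> \<beta> (v - i) x) :: real^('p + 'q)^('p + 'q))
      \<le> prod (f x) {v - n<..v}"
    if x: "\<And>i. 0 \<le> x $ i" and "v \<le> CARD('s)" "n \<le> v" for x n v
  proof -
    have "mnorm (mat_prod 0 n (\<lambda>i. phi \<alpha> \<beta> (v - i) x) :: real^('p + 'q)^('p + 'q))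
        \<le> (\<Prod>i<n. mnorm (phi \<alpha> \<beta> (v - i) x :: real^('p + 'q)^('p + 'q)))"
      by (rule mnorm_mat_prod_le)
    also have "\<dots> \<le> (\<Prod>i<n. f x (v - i))"
      using that by (intro prod_mono conjI mnorm_nonneg) (auto simp: f_def intro!: phi_le)
    also have "\<dots> = prod (f x) {v - n<..v}"
      using that by (intro prod.reindex_bij_witness[of _ "\<lambda>j. v - j" "\<lambda>i. v - i"]) auto
    finally show ?thesis .
  qed
  have prod_le_W: "mnorm (mat_prod 0 v (\<lambda>i. phi \<alpha> \<beta> (v - i) x) :: real^('p + 'q)^('p + 'q)) \<le> W x"
    if x: "\<And>i. 0 \<le> x $ i" and v: "v \<le> CARD('s)" for x v
    using prod_le[OF x v order_refl] sub[OF x, of "{v - v<..v}"] v by fastforce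
  have W0: "0 \<le> W x" if "\<And>i. 0 \<le> x $ i" for x
    using sub[OF that, of "{}"] by simp
  have pos: "position i \<le> CARD('s)" for i :: 's
    using position_in_range[of i] by simp
  let ?d = "real CARD('s \<times> ('p + 'q))"
  define C where "C = 1 + ?d * ?d + ?d * real CARD('s)"
  have C: "1 \<le> C" "?d * ?d \<le> C" "?d * real CARD('s) \<le> C"
    by (simp_all add: C_def del: card_prod card_sum)
  show ?thesis
  proof (rule that[OF c])
    show "0 \<le> C" using C by simp
  next
    fix x :: "real^'s::_" assume x: "\<And>i. 0 \<le> x $ i"
    have "mnorm (Phi \<alpha> \<beta> x :: real^('p + 'q)^('p + 'q)) \<le> W x"
      unfolding Phi_def by (rule prod_le_W[OF x order_refl])
    also have "\<dots> \<le> C * W x" using C W0[OF x] by (simp add: mult_le_cancel_right1)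
    finally show "mnorm (Phi \<alpha> \<beta> x :: real^('p + 'q)^('p + 'q)) \<le> C * (\<Prod>v = 1..CARD('s). c * (1 + x $ elt v))"
      by (simp only: W_def f_def)
  next
    fix x :: "real^'s::_" assume x: "\<And>i. 0 \<le> x $ i"
    have "\<bar>A_mat \<alpha> \<beta> x $ i $ j\<bar> \<le> W x" for i j :: "'s \<times> ('p + 'q)"
    proof -
      let ?P = "mat_prod 0 (position (fst i)) (\<lambda>k. phi \<alpha> \<beta> (position (fst i) - k) x) :: real^('p + 'q)^('p + 'q)"
      have "\<bar>?P $ snd i $ snd j\<bar> \<le> mnorm ?P" by (rule matrix_component_le_onorm)
      also have "\<dots> \<le> W x" by (rule prod_le_W[OF x pos])
      finally show ?thesis using W0[OF x] by (simp add: A_mat_def Let_def)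
    qed
    then have "mnorm (A_mat \<alpha> \<beta> x :: real^('s \<times> ('p + 'q))^('s \<times> ('p + 'q))) \<le> ?d * ?d * W x"
      by (rule onorm_le_matrix_component)
    also have "\<dots> \<le> C * W x" by (intro mult_right_mono C W0 x)
    finally show "mnorm (A_mat \<alpha> \<beta> x :: real^('s \<times> ('p + 'q))^('s \<times> ('p + 'q)))
        \<le> C * (\<Prod>v = 1..CARD('s). c * (1 + x $ elt v))"
      by (simp only: W_def f_def)
  next
    fix x :: "real^'s::_" assume x: "\<And>i. 0 \<le> x $ i"
    have "\<bar>B_vec \<alpha>0 \<alpha> \<beta> x $ r\<bar> \<le> real CARD('s) * W x" for r :: "'s \<times> ('p + 'q)"
    proof -
      let ?v = "position (fst r)"
      let ?t = "\<lambda>k. mat_prod 0 (?v - k) (\<lambda>i. phi \<alpha> \<beta> (?v - i) x) *v b_vec \<alpha>0 k x :: real^('p + 'q)"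
      have t: "norm (?t k) \<le> W x" if k: "k \<in> {1..?v}" for k
      proof -
        have k': "k \<in> {1..CARD('s)}" using k pos[of "fst r"] by auto
        have "norm (?t k) \<le> mnorm (mat_prod 0 (?v - k) (\<lambda>i. phi \<alpha> \<beta> (?v - i) x) :: real^('p + 'q)^('p + 'q))
            * norm (b_vec \<alpha>0 k x :: real^('p + 'q))"
          by (rule norm_matrix_vector_le)
        also have "\<dots> \<le> prod (f x) {?v - (?v - k)<..?v} * f x k"
          using b_le[OF k' x] f1[OF x]
          by (intro mult_mono prod_le x pos) (auto simp: f_def[symmetric] intro!: prod_nonneg intro: order_trans[OF zero_le_one f1[OF x]])
        also have "\<dots> = prod (f x) {k..?v}"
        proof -
          have "{k..?v} = insert k {k<..?v}" using k by auto
          then show ?thesis using k by (simp add: mult.commute)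
        qed
        also have "\<dots> \<le> W x" using k' pos[of "fst r"] by (intro sub x) auto
        finally show ?thesis .
      qed
      have "\<bar>B_vec \<alpha>0 \<alpha> \<beta> x $ r\<bar> \<le> norm (\<Sum>k = 1..?v. ?t k)"
        unfolding B_vec_def Let_def using component_le_norm_cart[of "\<Sum>k = 1..?v. ?t k" "snd r"] by simp
      also have "\<dots> \<le> (\<Sum>k = 1..?v. W x)" by (rule sum_norm_le) (rule t)
      also have "\<dots> \<le> real CARD('s) * W x" using pos[of "fst r"] W0[OF x] by (simp add: mult_right_mono)
      finally show ?thesis .
    qed
    then have "(\<Sum>r\<in>UNIV. \<bar>(B_vec \<alpha>0 \<alpha> \<beta> x :: real^('s \<times> ('p + 'q))) $ r\<bar>) \<le> ?d * (real CARD('s) * W x)"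
      by (intro sum_bounded_above)
    then have "norm (B_vec \<alpha>0 \<alpha> \<beta> x :: real^('s \<times> ('p + 'q))) \<le> ?d * real CARD('s) * W x"
      unfolding mult.assoc using norm_le_l1_cart order_trans by blast
    also have "\<dots> \<le> C * W x" by (intro mult_right_mono C W0 x)
    finally show "norm (B_vec \<alpha>0 \<alpha> \<beta> x :: real^('s \<times> ('p + 'q)))
        \<le> C * (\<Prod>v = 1..CARD('s). c * (1 + x $ elt v))"
      by (simp only: W_def f_def)
  qed
qed

section \<open>Stationarity of the periodic GARCH process\<close>

lemma series_term_eq:
  "series_term \<alpha>0 \<alpha> \<beta> \<eta> t \<omega> k
    = back_prod (A_mat \<alpha> \<beta>) k t (\<lambda>t. \<eta> t \<omega>) *v B_vec \<alpha>0 \<alpha> \<beta> (\<eta> (t - int k) \<omega>)"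
  by (simp add: series_term_def back_prod_def)

theorem theorem2:
  fixes M :: "'a measure"
    and \<alpha>0 :: "nat \<Rightarrow> real"
    and \<alpha> \<beta> :: "nat \<Rightarrow> nat \<Rightarrow> real"
    and \<epsilon> :: "int \<Rightarrow> 'a \<Rightarrow> real"
    and \<eta> :: "int \<Rightarrow> 'a \<Rightarrow> real^'s::{finite,linorder}"
    and Y :: "int \<Rightarrow> 'a \<Rightarrow> real^('s \<times> ('p::{finite,linorder} + 'q::{finite,linorder}))"
  assumes M: "prob_space M"
    and \<alpha>0_pos: "\<And>v. v \<in> {1..CARD('s)} \<Longrightarrow> \<alpha>0 v > 0"
    and \<alpha>_nonneg: "\<And>i v. i \<in> {1..CARD('p)} \<Longrightarrow> v \<in> {1..CARD('s)} \<Longrightarrow> \<alpha> i v \<ge> 0"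
    and \<beta>_nonneg: "\<And>j v. j \<in> {1..CARD('q)} \<Longrightarrow> v \<in> {1..CARD('s)} \<Longrightarrow> \<beta> j v \<ge> 0"
    and \<epsilon>_indep: "prob_space.indep_vars M (\<lambda>_. borel) \<epsilon> UNIV"
    and \<epsilon>_ident: "\<And>t. distr M borel (\<epsilon> t) = distr M borel (\<epsilon> 0)"
    and \<epsilon>_integrable: "\<And>t. integrable M (\<lambda>\<omega>. (\<epsilon> t \<omega>) ^ 3)"
    and \<epsilon>_moments: "\<And>t. (\<integral>\<omega>. \<epsilon> t \<omega> \<partial>M) = 0" "\<And>t. (\<integral>\<omega>. (\<epsilon> t \<omega>) ^ 3 \<partial>M) = 0"
      "\<And>t. (\<integral>\<omega>. (\<epsilon> t \<omega>) ^ 2 \<partial>M) = 1"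
    and \<eta>: "\<And>t \<omega>. \<eta> t \<omega> = (\<chi> v. (\<epsilon> (int CARD('s) * t + int (position v)) \<omega>) ^ 2)"
    and Y: "\<And>t \<omega>. Y t \<omega> =
      (\<Sum>k. series_term \<alpha>0 \<alpha> \<beta> \<eta> t \<omega> (Suc k)) + B_vec \<alpha>0 \<alpha> \<beta> (\<eta> t \<omega>)"
    and lyapunov: "top_lyapunov M
      (\<lambda>t \<omega>. Phi \<alpha> \<beta> (\<eta> t \<omega>) :: real^('p + 'q)^('p + 'q)) < 0"
  shows "(\<forall>t. AE \<omega> in M. summable
           (series_term \<alpha>0 \<alpha> \<beta> \<eta> t \<omega> :: nat \<Rightarrow> real^('s \<times> ('p + 'q)))) \<and>
         stationary_causal_ergodic_solution M \<alpha>0 \<alpha> \<beta> \<eta> Y \<and>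
         (\<forall>Z :: int \<Rightarrow> 'a \<Rightarrow> real^('s \<times> ('p + 'q)).
            stationary_causal_ergodic_solution M \<alpha>0 \<alpha> \<beta> \<eta> Z \<longrightarrow>
            (\<forall>t. AE \<omega> in M. Z t \<omega> = Y t \<omega>))"
proof -
  interpret M: prob_space M by (rule M)
  interpret \<epsilon>: iid_process M \<epsilon>
    by standard (rule \<epsilon>_indep, rule \<epsilon>_ident)
  interpret \<eta>: iid_process M \<eta>
  proof -
    let ?F = "\<lambda>z :: int \<Rightarrow> real. (\<chi> v. (z (int (position v))) ^ 2) :: real^'s::_"
    have "?F \<in> borel_measurable path_space"
      by (rule borel_measurable_vecI) simp
    moreover have "int (position i) \<in> {1..int CARD('s)}" for i :: 's
      using position_in_range[of i] by simp
    then have "depends_on {1..int CARD('s)} ?F"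
      unfolding depends_on_def vec_eq_iff by (metis vec_lambda_beta)
    ultimately have "iid_process M (\<lambda>t \<omega>. ?F (\<lambda>i. \<epsilon> (i + int CARD('s) * t) \<omega>))"
      by (rule \<epsilon>.iid_process_blocks)
    moreover have "(\<lambda>t \<omega>. ?F (\<lambda>i. \<epsilon> (i + int CARD('s) * t) \<omega>)) = \<eta>"
      by (intro ext) (simp add: \<eta> add.commute)
    ultimately show "iid_process M \<eta>" by simp
  qed
  let ?G = "Phi \<alpha> \<beta> :: real^'s::_ \<Rightarrow> real^('p + 'q)^('p + 'q)"
  let ?A = "A_mat \<alpha> \<beta> :: real^'s::_ \<Rightarrow> real^('s \<times> ('p + 'q))^('s \<times> ('p + 'q))"
  let ?B = "B_vec \<alpha>0 \<alpha> \<beta> :: real^'s::_ \<Rightarrow> real^('s \<times> ('p + 'q))"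
  obtain c C where c: "1 \<le> c" and C: "0 \<le> C"
    and G_le: "\<And>x. (\<And>i. 0 \<le> x $ i) \<Longrightarrow> mnorm (?G x) \<le> C * (\<Prod>v = 1..CARD('s). c * (1 + x $ elt v))"
    and A_le: "\<And>x. (\<And>i. 0 \<le> x $ i) \<Longrightarrow> mnorm (?A x) \<le> C * (\<Prod>v = 1..CARD('s). c * (1 + x $ elt v))"
    and B_le: "\<And>x. (\<And>i. 0 \<le> x $ i) \<Longrightarrow> norm (?B x) \<le> C * (\<Prod>v = 1..CARD('s). c * (1 + x $ elt v))"
    using period_bound[where 's = 's and 'p = 'p and 'q = 'q and ?\<alpha>0.0 = \<alpha>0 and \<alpha> = \<alpha> and \<beta> = \<beta>]
    by blast
  have \<eta>_nonneg: "0 \<le> \<eta> t \<omega> $ i" for t \<omega> i by (simp add: \<eta>)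
  define e where "e j \<omega> = c * (1 + (\<epsilon> j \<omega>)\<^sup>2)" for j \<omega>
  have e0: "0 \<le> e j \<omega>" for j \<omega> using c by (simp add: e_def)
  have e_int: "(\<integral>\<^sup>+\<omega>. ennreal (e j \<omega>) \<partial>M) < \<infinity>" for j
  proof -
    have "integrable M (\<lambda>\<omega>. (\<epsilon> j \<omega>)\<^sup>2)"
      using \<epsilon>_moments(3)[of j] not_integrable_integral_eq[of M "\<lambda>\<omega>. (\<epsilon> j \<omega>)\<^sup>2"] by fastforce
    then have "integrable M (e j)" unfolding e_def[abs_def] by simp
    then show ?thesis using e0 by (simp add: nn_integral_eq_integral)
  qed
  \<comment> \<open>The innovations of one period are independent and have finite second moments.\<close>
  have period_int: "(\<integral>\<^sup>+\<omega>. ennreal (h \<omega>) \<partial>M) < \<infinity>"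
    if h: "\<And>\<omega>. h \<omega> \<le> C * (\<Prod>v = 1..CARD('s). c * (1 + \<eta> 0 \<omega> $ elt v))" for h
  proof -
    have "h \<omega> \<le> C * (\<Prod>j\<in>int ` {1..CARD('s)}. e j \<omega>)" for \<omega>
      using h[of \<omega>] by (subst prod.reindex) (auto simp: \<eta> e_def position_elt)
    then have "(\<integral>\<^sup>+\<omega>. ennreal (h \<omega>) \<partial>M)
        \<le> (\<integral>\<^sup>+\<omega>. ennreal C * (\<Prod>j\<in>int ` {1..CARD('s)}. ennreal (e j \<omega>)) \<partial>M)"
      using C e0 by (intro nn_integral_mono) (simp add: prod_ennreal prod_nonneg ennreal_leI flip: ennreal_mult)
    also have "\<dots> = ennreal C * (\<integral>\<^sup>+\<omega>. (\<Prod>j\<in>int ` {1..CARD('s)}. ennreal (e j \<omega>)) \<partial>M)"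
      unfolding e_def by (intro nn_integral_cmult) measurable
    also have "(\<integral>\<^sup>+\<omega>. (\<Prod>j\<in>int ` {1..CARD('s)}. ennreal (e j \<omega>)) \<partial>M)
        = (\<Prod>j\<in>int ` {1..CARD('s)}. \<integral>\<^sup>+\<omega>. ennreal (e j \<omega>) \<partial>M)"
    proof (rule M.indep_vars_nn_integral)
      have "M.indep_vars (\<lambda>_. borel) (\<lambda>j \<omega>. ennreal (c * (1 + (\<epsilon> j \<omega>)\<^sup>2))) UNIV"
        by (rule M.indep_vars_compose2[OF \<epsilon>_indep]) measurable
      then show "M.indep_vars (\<lambda>_. borel) (\<lambda>j \<omega>. ennreal (e j \<omega>)) (int ` {1..CARD('s)})"
        unfolding e_def by (rule M.indep_vars_subset) simp
    qed auto
    also have "ennreal C * \<dots> < \<infinity>"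
    proof -
      have "(\<Prod>j\<in>J. \<integral>\<^sup>+\<omega>. ennreal (e j \<omega>) \<partial>M) < \<infinity>" if "finite J" for J
        using that e_int by induction (auto simp: ennreal_mult_less_top)
      then show ?thesis by (simp add: ennreal_mult_less_top)
    qed
    finally show ?thesis .
  qed
  have int_G: "(\<integral>\<^sup>+\<omega>. ennreal (mnorm (?G (\<eta> 0 \<omega>))) \<partial>M) < \<infinity>"
    by (intro period_int G_le \<eta>_nonneg)
  have int_A: "(\<integral>\<^sup>+\<omega>. ennreal (mnorm (?A (\<eta> 0 \<omega>))) \<partial>M) < \<infinity>"
    by (intro period_int A_le \<eta>_nonneg)
  have int_B: "(\<integral>\<^sup>+\<omega>. ennreal (norm (?B (\<eta> 0 \<omega>))) \<partial>M) < \<infinity>"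
    by (intro period_int B_le \<eta>_nonneg)
  \<comment> \<open>A negative exponent gives a length \<open>N\<close> whose product has negative expected logarithm.\<close>
  obtain \<delta> where \<delta>: "0 < \<delta>" "\<delta> \<le> 1" and moments: "(\<Sum>k. \<eta>.moment ?G \<delta> k) < \<infinity>"
  proof -
    obtain N :: nat where N: "1 \<le> N" and neg: "expectation_ext M (\<lambda>\<omega>. ereal (1 / real N) *
        log_ext (mnorm (mat_prod 1 (Suc N) (\<lambda>i. ?G (\<eta> (int N - int i) \<omega>))))) < 0"
      using lyapunov unfolding top_lyapunov_def INF_less_iff by auto
    define W where "W \<omega> = mnorm (back_prod ?G N (int N - 1) (\<lambda>t. \<eta> t \<omega>))" for \<omega>
    have W_eq: "mnorm (mat_prod 1 (Suc N) (\<lambda>i. ?G (\<eta> (int N - int i) \<omega>))) = W \<omega>" for \<omega>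
      by (simp add: W_def back_prod_def mat_prod_Suc_Suc diff_diff_eq)
    have W_meas [measurable]: "W \<in> borel_measurable M"
      unfolding W_def[abs_def]
      by (rule measurable_compose[OF \<eta>.measurable_path
            measurable_compose[OF borel_measurable_back_prod[OF borel_measurable_Phi] borel_measurable_mnorm]])
    have W0: "0 \<le> W \<omega>" for \<omega> unfolding W_def by (rule mnorm_nonneg)
    have "(\<integral>\<^sup>+\<omega>. ennreal (W \<omega>) \<partial>M) = \<eta>.moment ?G 1 N"
      unfolding \<eta>.moment_eq[OF borel_measurable_Phi, where t = "int N - 1", symmetric]
      using W0 by (intro nn_integral_cong) (simp add: W_def)
    also have "\<dots> < \<infinity>"
      by (rule \<eta>.moment_finite[OF borel_measurable_Phi _ _ int_G]) auto
    finally have W_int: "(\<integral>\<^sup>+\<omega>. ennreal (W \<omega>) \<partial>M) < \<infinity>" .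
    have log: "(\<integral>\<^sup>+\<omega>. e2ennreal (log_ext (W \<omega>)) \<partial>M) < (\<integral>\<^sup>+\<omega>. e2ennreal (- log_ext (W \<omega>)) \<partial>M)"
    proof (rule ccontr)
      assume "\<not> ?thesis"
      then have "ennreal (1 / real N) * (\<integral>\<^sup>+\<omega>. e2ennreal (- log_ext (W \<omega>)) \<partial>M)
          \<le> ennreal (1 / real N) * (\<integral>\<^sup>+\<omega>. e2ennreal (log_ext (W \<omega>)) \<partial>M)"
        by (intro mult_left_mono) (auto simp: not_less)
      moreover have "ereal (1 / real N) * - x = - (ereal (1 / real N) * x)" for x by simp
      ultimately show False
        using expectation_ext_negD[OF neg[unfolded W_eq]] N
        by (simp add: e2ennreal_cmult nn_integral_cmult not_less[symmetric] flip: ereal_mult_minus_right)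
    qed
    obtain \<delta> where \<delta>: "0 < \<delta>" "\<delta> \<le> 1" and "(\<integral>\<^sup>+\<omega>. ennreal (W \<omega> powr \<delta>) \<partial>M) < 1"
      by (rule M.power_mean_less_1[OF W_meas W0 W_int log])
    then have "\<eta>.moment ?G \<delta> N < 1"
      unfolding W_def \<eta>.moment_eq[OF borel_measurable_Phi] by simp
    from \<eta>.summable_moments[OF borel_measurable_Phi _ _ int_G this] \<delta>
    show ?thesis by (intro that) auto
  qed
  interpret affine_recursion M \<eta> ?A ?B ?G last_incl last_proj \<delta>
    by standard (intro borel_measurable_A_mat borel_measurable_B_vec borel_measurable_Phi A_mat_factor
        last_proj_A_mat \<delta> int_A int_B moments)+
  have Y': "Y t \<omega> = (\<Sum>k. back_prod ?A (Suc k) t (\<lambda>t. \<eta> t \<omega>) *v ?B (\<eta> (t - int (Suc k)) \<omega>)) + ?B (\<eta> t \<omega>)" for t \<omega>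
    unfolding Y series_term_eq ..
  note solves = AE_series_solves[OF Y']
    and stationary = stationary_ergodic_series(1)[OF Y']
  have "stationary_causal_ergodic_solution M \<alpha>0 \<alpha> \<beta> \<eta> Y"
    unfolding stationary_causal_ergodic_solution_def
    using solves stationary stationary_ergodic_series(2)[OF Y'] causal_series[OF Y'] by blast
  moreover have "AE \<omega> in M. Z t \<omega> = Y t \<omega>"
    if "stationary_causal_ergodic_solution M \<alpha>0 \<alpha> \<beta> \<eta> Z" for Z t
    using that unfolding stationary_causal_ergodic_solution_def
    by (intro AE_solution_unique[OF stationary _ solves]) blast+
  moreover have "AE \<omega> in M. summable (series_term \<alpha>0 \<alpha> \<beta> \<eta> t \<omega> :: nat \<Rightarrow> real^('s \<times> ('p + 'q)))" for t
    using AE_summable_series[of t] unfolding series_term_eq[abs_def] .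
  ultimately show ?thesis by blast
qed

end
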